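(* If a graph $H$ is strongly tree decomposable, then $H$ has Sidorenko's property.
   Context: All graphs are finite and simple. For graphs $H,G$, $\mathrm{Hom}(H,G)$ denotes the set of homomorphisms from $H$ to $G$, i.e. maps $g:V(H)\to V(G)$ such that $\{g(v),g(w)\}\in E(G)$ whenever $\{v,w\}\in E(H)$. A graph $H$ has Sidorenko's property if for every graph $G$, $$|\mathrm{Hom}(H,G)|\ge |V(G)|^{|V(H)|}\left(\frac{2|E(G)|}{|V(G)|^2}\right)^{|E(H)|}.$$ A tree decomposition of a graph $H$ is a pair $(\mathcal{F},\mathcal{T})$ where $\mathcal{F}$ is a family of subsets of $V(H)$ and $\mathcal{T}$ is a tree with vertex set $\mathcal{F}$ such that: (1) $\bigcup_{X\in\mathcal{F}}X=V(H)$; (2) for every edge $\{v,w\}\in E(H)$ there is $X\in\mathcal{F}$ with $v,w\in X$; (3) for $X,Y,Z\in\mathcal{F}$, $X\cap Y\subseteq Z$ whenever $Z$ lies on the path from $X$ to $Y$ in $\mathcal{T}$. A strong tree decomposition is a tree decomposition $(\mathcal{F},\mathcal{T})$ such that additionally: (a) the induced subgraphs $H[X]$, $X\in\mathcal{F}$, are pairwise edge-disjoint trees; (b) for every pair $X,Y\in\mathcal{F}$ adjacent in $\mathcal{T}$, there is an isomorphism fixing $X\cap Y$ (pointwise) between the minimal subtree of $H[X]$ containing $X\cap Y$ and the minimal subtree of $H[Y]$ containing $X\cap Y$. $H$ is strongly tree decomposable if it has a strong tree decomposition. *)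

theory Defs
  imports Complex_Main "HOL-Library.FuncSet"
begin

section \<open>Finite simple graphs\<close>

text \<open>
  Edges are unordered pairs, so that the number of edges is the cardinality of \<open>edges G\<close>.
  We do not use the symmetric digraphs of the AFP entry Graph-Theory: in its notion of a
  tree the closed walk \<open>a, b, a\<close> counts as a cycle, which excludes every symmetric digraph
  with an edge.
\<close>

datatype 'a sgraph = SGraph (vertices: "'a set") (edges: "'a set set")

definition simple_graph :: "'a sgraph \<Rightarrow> bool" where
  "simple_graph G \<longleftrightarrow>
     finite (vertices G) \<and> (\<forall>e\<in>edges G. e \<subseteq> vertices G \<and> card e = 2)"

definition is_subgraph :: "'a sgraph \<Rightarrow> 'a sgraph \<Rightarrow> bool" where
  "is_subgraph G' G \<longleftrightarrow>
     simple_graph G' \<and> vertices G' \<subseteq> vertices G \<and> edges G' \<subseteq> edges G"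

definition induced :: "'a sgraph \<Rightarrow> 'a set \<Rightarrow> 'a sgraph" where
  "induced G X = SGraph X {e \<in> edges G. e \<subseteq> X}"

definition is_path :: "'a sgraph \<Rightarrow> 'a list \<Rightarrow> bool" where
  "is_path G p \<longleftrightarrow> p \<noteq> [] \<and> distinct p \<and> set p \<subseteq> vertices G \<and>
     successively (\<lambda>u v. {u, v} \<in> edges G) p"

definition path_between :: "'a sgraph \<Rightarrow> 'a \<Rightarrow> 'a list \<Rightarrow> 'a \<Rightarrow> bool" where
  "path_between G u p v \<longleftrightarrow> is_path G p \<and> hd p = u \<and> last p = v"

definition is_cycle :: "'a sgraph \<Rightarrow> 'a list \<Rightarrow> bool" where
  "is_cycle G p \<longleftrightarrow> is_path G p \<and> 3 \<le> length p \<and> {last p, hd p} \<in> edges G"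

definition is_connected :: "'a sgraph \<Rightarrow> bool" where
  "is_connected G \<longleftrightarrow>
     vertices G \<noteq> {} \<and> (\<forall>u\<in>vertices G. \<forall>v\<in>vertices G. \<exists>p. path_between G u p v)"

definition is_tree :: "'a sgraph \<Rightarrow> bool" where
  "is_tree G \<longleftrightarrow> simple_graph G \<and> is_connected G \<and> (\<nexists>p. is_cycle G p)"

definition is_isomorphism :: "('a \<Rightarrow> 'b) \<Rightarrow> 'a sgraph \<Rightarrow> 'b sgraph \<Rightarrow> bool" where
  "is_isomorphism f A B \<longleftrightarrow> bij_betw f (vertices A) (vertices B) \<and>
     (\<forall>v\<in>vertices A. \<forall>w\<in>vertices A. {v, w} \<in> edges A \<longleftrightarrow> {f v, f w} \<in> edges B)"

section \<open>Homomorphisms and Sidorenko's property\<close>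

text \<open>
  Homomorphisms are maps on the vertex set only; as HOL functions they are taken to be
  \<open>undefined\<close> outside \<open>vertices H\<close>, so that the cardinality counts each map once.
\<close>

definition Hom :: "'a sgraph \<Rightarrow> 'b sgraph \<Rightarrow> ('a \<Rightarrow> 'b) set" where
  "Hom H G = {g \<in> vertices H \<rightarrow>\<^sub>E vertices G.
     \<forall>v w. {v, w} \<in> edges H \<longrightarrow> {g v, g w} \<in> edges G}"

text \<open>
  The type argument carries the vertices of the host graph \<open>G\<close>, since HOL cannot quantify
  over types inside a definition. Every finite graph is isomorphic to one with vertices in
  \<^typ>\<open>nat\<close>. For the graph without vertices, division by zero
  makes the edge density 0.
\<close>

definition sidorenko_property :: "'b itself \<Rightarrow> 'a sgraph \<Rightarrow> bool" where
  "sidorenko_property _ H \<longleftrightarrow>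
     (\<forall>G :: 'b sgraph. simple_graph G \<longrightarrow>
        real (card (Hom H G)) \<ge>
          real (card (vertices G)) ^ card (vertices H) *
          (2 * real (card (edges G)) / real (card (vertices G)) ^ 2) ^ card (edges H))"

section \<open>Strong tree decompositions\<close>

definition tree_decomposition ::
  "'a sgraph \<Rightarrow> 'a set set \<Rightarrow> 'a set sgraph \<Rightarrow> bool" where
  "tree_decomposition H \<F> \<T> \<longleftrightarrow>
     (\<forall>X\<in>\<F>. X \<subseteq> vertices H) \<and>
     is_tree \<T> \<and> vertices \<T> = \<F> \<and>
     \<Union>\<F> = vertices H \<and>
     (\<forall>v w. {v, w} \<in> edges H \<longrightarrow> (\<exists>X\<in>\<F>. v \<in> X \<and> w \<in> X)) \<and>
     (\<forall>X\<in>\<F>. \<forall>Y\<in>\<F>. \<forall>Z\<in>\<F>. \<forall>p.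
        path_between \<T> X p Y \<and> Z \<in> set p \<longrightarrow> X \<inter> Y \<subseteq> Z)"

text \<open>
  For nonempty \<open>S\<close>, a tree has exactly one minimal subtree containing \<open>S\<close>. For empty \<open>S\<close>
  the minimal subtrees are the single vertices, and any two of them are isomorphic.
\<close>

definition minimal_subtree :: "'a sgraph \<Rightarrow> 'a set \<Rightarrow> 'a sgraph \<Rightarrow> bool" where
  "minimal_subtree T S M \<longleftrightarrow>
     is_subgraph M T \<and> is_tree M \<and> S \<subseteq> vertices M \<and>
     (\<forall>M'. is_subgraph M' M \<and> is_tree M' \<and> S \<subseteq> vertices M' \<longrightarrow> M' = M)"

definition strong_tree_decomposition ::
  "'a sgraph \<Rightarrow> 'a set set \<Rightarrow> 'a set sgraph \<Rightarrow> bool" where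
  "strong_tree_decomposition H \<F> \<T> \<longleftrightarrow>
     tree_decomposition H \<F> \<T> \<and>
     (\<forall>X\<in>\<F>. is_tree (induced H X)) \<and>
     (\<forall>X\<in>\<F>. \<forall>Y\<in>\<F>. X \<noteq> Y \<longrightarrow> edges (induced H X) \<inter> edges (induced H Y) = {}) \<and>
     (\<forall>X\<in>\<F>. \<forall>Y\<in>\<F>. {X, Y} \<in> edges \<T> \<longrightarrow>
        (\<exists>A B f. minimal_subtree (induced H X) (X \<inter> Y) A \<and>
                 minimal_subtree (induced H Y) (X \<inter> Y) B \<and>
                 is_isomorphism f A B \<and> (\<forall>v\<in>X \<inter> Y. f v = v)))"

definition strongly_tree_decomposable :: "'a sgraph \<Rightarrow> bool" where
  "strongly_tree_decomposable H \<longleftrightarrow> (\<exists>\<F> \<T>. strong_tree_decomposition H \<F> \<T>)"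

end

(*
Let G have m > 0 edges and let pi be the stationary distribution of its random walk. Each bag of
the decomposition is mapped to G by the stationary random walk indexed by its tree; two adjacent
bags induce the same law on their intersection, because this law depends only on the minimal
subtree spanned by it. Hence the bags can be coupled along the decomposition tree, independently
given the intersections, to a random homomorphism from H to G. Its entropy is the sum of the
entropies of the bags minus those of the intersections; bounding the latter by the sum of the
vertex entropies leaves |V'| h + |E(H)| (ln (2m) - 2 h) for the set V' of non-isolated vertices,
where h is the entropy of pi, plus ln |V(G)| for each isolated vertex. Now |V'| <= 2 |E(H)| and
h <= ln |V(G)|, while the entropy is at most ln |Hom(H, G)|.
*)
theory Submission
  imports Defs
begin

section \<open>Growing trees vertex by vertex\<close>

text \<open>The path condition is what allows the coupling to be built one bag at a time. If the
  bags placed so far form a connected part of the decomposition tree and \<open>Y\<close> is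
  adjacent to one of them, \<open>X\<close>, then \<open>Y\<close> meets their whole union only in
  \<open>X \<inter> Y\<close>, so it is enough that the laws of \<open>X\<close> and
  \<open>Y\<close> agree there. The entropies of the intersections have no closed form and are only
  bounded. A vertex has the same law in every bag containing it, so by inclusion-exclusion each
  vertex of H is counted once; edge-disjointness of the bags does the same for edges. With n =
  |V(G)|, the resulting bound exceeds the logarithm of Sidorenko's bound by (2|E(H)| - |V'|)(ln n -
  h), a product of nonnegative factors. A stationary image of an isolated vertex would lower the
  first factor by one and could make it negative; a uniform image has entropy exactly ln n and
  leaves the product unchanged. The development works with sums of f ln f, that is, with negative
  entropies, so all these bounds appear reversed.\<close>

lemma path_between_mono:
  assumes "path_between A u p v" "vertices A \<subseteq> vertices B" "edges A \<subseteq> edges B"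
  shows "path_between B u p v"
proof -
  have "successively (\<lambda>u v. {u, v} \<in> edges B) p"
    by (rule successively_mono[where P = "\<lambda>u v. {u, v} \<in> edges A"])
      (use assms in \<open>auto simp: path_between_def is_path_def\<close>)
  then show ?thesis
    using assms by (auto simp: path_between_def is_path_def)
qed

lemma path_between_set: "path_between G u p v \<Longrightarrow> set p \<subseteq> vertices G"
  by (simp add: path_between_def is_path_def)

lemma path_between_singleton: "v \<in> vertices G \<Longrightarrow> path_between G v [v] v"
  by (simp add: path_between_def is_path_def)

lemma path_between_snoc:
  assumes "path_between G x p u" "{u, w} \<in> edges G" "w \<in> vertices G" "w \<notin> set p"
  shows "path_between G x (p @ [w]) w"
  using assms by (auto simp: path_between_def is_path_def successively_append_iff)

lemma path_between_Cons:
  assumes "path_between G u p x" "{w, u} \<in> edges G" "w \<in> vertices G" "w \<notin> set p"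
  shows "path_between G w (w # p) x"
  using assms by (cases p) (auto simp: path_between_def is_path_def)

lemma simple_graphD:
  assumes "simple_graph G"
  shows "finite (vertices G)" "finite (edges G)"
    and "e \<in> edges G \<Longrightarrow> finite e" "e \<in> edges G \<Longrightarrow> card e = 2"
    and "e \<in> edges G \<Longrightarrow> e \<subseteq> vertices G"
    and "{u, v} \<in> edges G \<Longrightarrow> u \<noteq> v \<and> u \<in> vertices G \<and> v \<in> vertices G"
proof -
  have *: "finite (vertices G)" "\<And>e. e \<in> edges G \<Longrightarrow> e \<subseteq> vertices G \<and> card e = 2"
    using assms by (auto simp: simple_graph_def)
  then have "edges G \<subseteq> Pow (vertices G)" by auto
  with *(1) show "finite (edges G)" by (meson finite_Pow_iff finite_subset)
  show "finite (vertices G)" "e \<in> edges G \<Longrightarrow> finite e" "e \<in> edges G \<Longrightarrow> card e = 2"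
    "e \<in> edges G \<Longrightarrow> e \<subseteq> vertices G"
    using * finite_subset by blast+
  show "{u, v} \<in> edges G \<Longrightarrow> u \<noteq> v \<and> u \<in> vertices G \<and> v \<in> vertices G"
    using *(2)[of "{u, v}"] by (auto simp: card_insert_if split: if_splits)
qed

lemma connected_vertex_in_edge:
  assumes "is_connected G" "x \<in> vertices G" "y \<in> vertices G" "x \<noteq> y"
  shows "x \<in> \<Union>(edges G)"
proof -
  obtain p where p: "path_between G x p y"
    using assms unfolding is_connected_def by blast
  then obtain z q where "p = x # z # q"
    using \<open>x \<noteq> y\<close> by (cases p; cases "tl p") (auto simp: path_between_def is_path_def)
  with p have "{x, z} \<in> edges G"
    by (simp add: path_between_def is_path_def)
  then show ?thesis by blast
qed

lemma connected_crossing_edge: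
  assumes "is_connected G" "a \<in> B" "a \<in> vertices G" "b \<in> vertices G" "b \<notin> B"
  obtains u w where "u \<in> B" "w \<notin> B" "{u, w} \<in> edges G" "w \<in> vertices G"
proof -
  obtain p where p: "path_between G a p b"
    using assms unfolding is_connected_def by blast
  have "\<exists>u w. u \<in> B \<and> w \<notin> B \<and> {u, w} \<in> edges G \<and> w \<in> vertices G"
    if "p \<noteq> []" "hd p \<in> B" "last p \<notin> B" "set p \<subseteq> vertices G"
      "successively (\<lambda>u v. {u, v} \<in> edges G) p" for p
    using that
  proof (induction p rule: induct_list012)
    case (3 x y zs)
    then show ?case by (cases "y \<in> B") auto
  qed auto
  from this[of p] p assms that show ?thesis
    by (auto simp: path_between_def is_path_def)
qed

definition attach :: "'a sgraph \<Rightarrow> 'a \<Rightarrow> 'a \<Rightarrow> 'a sgraph" where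
  "attach B u w = SGraph (insert w (vertices B)) (insert {u, w} (edges B))"

lemma attach_simps [simp]:
  "vertices (attach B u w) = insert w (vertices B)"
  "edges (attach B u w) = insert {u, w} (edges B)"
  by (simp_all add: attach_def)

lemma connected_attach:
  assumes "is_connected B" "u \<in> vertices B" "w \<notin> vertices B"
  shows "is_connected (attach B u w)"
  unfolding is_connected_def
proof (intro conjI ballI)
  let ?C = "attach B u w"
  have path: "\<exists>p. path_between B x p y" if "x \<in> vertices B" "y \<in> vertices B" for x y
    using assms(1) that unfolding is_connected_def by blast
  have lift: "path_between ?C x p y" if "path_between B x p y" for x p y
    by (rule path_between_mono[OF that]) auto
  fix x y assume x: "x \<in> vertices ?C" and y: "y \<in> vertices ?C"
  consider "x \<in> vertices B" "y \<in> vertices B" | "x \<in> vertices B" "y = w"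
    | "x = w" "y \<in> vertices B" | "x = w" "y = w"
    using x y by auto
  then show "\<exists>p. path_between ?C x p y"
  proof cases
    case 1
    then show ?thesis using path lift by blast
  next
    case 2
    obtain p where p: "path_between B x p u" using path 2 assms(2) by blast
    then have "path_between ?C x (p @ [w]) w"
      using assms(3) path_between_set[OF p] by (intro path_between_snoc[OF lift[OF p]]) auto
    then show ?thesis using 2 by blast
  next
    case 3
    obtain p where p: "path_between B u p y" using path 3 assms(2) by blast
    then have "path_between ?C w (w # p) y"
      using assms(3) path_between_set[OF p]
      by (intro path_between_Cons[OF lift[OF p]]) (auto simp: insert_commute)
    then show ?thesis using 3 by blast
  next
    case 4
    then show ?thesis using path_between_singleton[of w ?C] by auto
  qed
qed auto

lemma connected_singleton: "is_connected (SGraph {v} {})"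
  using path_between_singleton[of v "SGraph {v} {}"] by (auto simp: is_connected_def)

text \<open>An edge of \<open>T\<close> missing from \<open>B\<close> would close a cycle with the
  path of \<open>B\<close> between its ends.\<close>

lemma tree_eq_if_spanning:
  assumes T: "is_tree T" and B: "is_subgraph B T" "is_connected B" "vertices B = vertices T"
  shows "B = T"
proof -
  have "e \<in> edges B" if e: "e \<in> edges T" for e
  proof (rule ccontr)
    assume nB: "e \<notin> edges B"
    have sT: "simple_graph T" using T by (simp add: is_tree_def)
    obtain a b where ab: "e = {a, b}" "a \<noteq> b"
      using simple_graphD(4)[OF sT e] by (auto simp: card_2_iff)
    have "a \<in> vertices B" "b \<in> vertices B"
      using simple_graphD(5)[OF sT e] ab B(3) by auto
    then obtain p where p: "path_between B a p b"
      using B(2) unfolding is_connected_def by blast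
    have pB: "p \<noteq> []" "hd p = a" "last p = b" "successively (\<lambda>u v. {u, v} \<in> edges B) p"
      using p by (simp_all add: path_between_def is_path_def)
    obtain q where q: "p = a # q" using pB(1,2) by (cases p) simp_all
    obtain c r where r: "q = c # r" using pB(3) q ab(2) by (cases q) simp_all
    \<comment> \<open>If the path consisted of \<open>a\<close> and \<open>b\<close> only,
      \<open>e\<close> itself would be an edge of \<open>B\<close>.\<close>
    have "r \<noteq> []" using pB(3,4) q r ab(1) nB by auto
    then have "3 \<le> length p" using q r by (cases r) simp_all
    moreover have "path_between T a p b"
      using path_between_mono[OF p] B(1) by (simp add: is_subgraph_def)
    ultimately have "is_cycle T p"
      using e ab by (auto simp: is_cycle_def path_between_def insert_commute)
    with T show False by (simp add: is_tree_def)
  qed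
  with B show ?thesis
    by (intro sgraph.expand) (auto simp: is_subgraph_def)
qed

text \<open>As long as vertices are missing, connectedness gives an edge of \<open>T\<close> leaving
  \<open>B\<close>; once all are present, acyclicity leaves no edge to add. Starting from a single
  vertex this is the usual leaf induction; starting from a subtree it compares the subtree with the
  whole tree. It is applied both to the bags and to the decomposition tree.\<close>

lemma tree_induct [consumes 3, case_names base attach]:
  assumes T: "is_tree T" and A: "is_subgraph A T" "is_connected A"
    and base: "P A"
    and step: "\<And>B u w. is_subgraph B T \<Longrightarrow> is_connected B \<Longrightarrow> P B \<Longrightarrow> u \<in> vertices B \<Longrightarrow>
      w \<in> vertices T \<Longrightarrow> w \<notin> vertices B \<Longrightarrow> {u, w} \<in> edges T \<Longrightarrow> P (attach B u w)"
  shows "P T"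
proof -
  have sT: "simple_graph T" and cT: "is_connected T" using T by (simp_all add: is_tree_def)
  have "P T" if "is_subgraph B T" "is_connected B" "P B" for B
    using that
  proof (induction "card (vertices T - vertices B)" arbitrary: B rule: less_induct)
    case less
    show ?case
    proof (cases "vertices B = vertices T")
      case True
      then show ?thesis using tree_eq_if_spanning[OF T] less.prems by metis
    next
      case False
      have BT: "simple_graph B" "vertices B \<subseteq> vertices T" "edges B \<subseteq> edges T"
        using less.prems(1) by (auto simp: is_subgraph_def)
      obtain a where "a \<in> vertices B" using less.prems(2) by (auto simp: is_connected_def)
      moreover obtain b where "b \<in> vertices T" "b \<notin> vertices B" using False BT by blast
      ultimately obtain u w where uw: "u \<in> vertices B" "w \<notin> vertices B" "{u, w} \<in> edges T"
          "w \<in> vertices T"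
        using connected_crossing_edge[OF cT, of a "vertices B" b] BT by blast
      have "is_subgraph (attach B u w) T"
        using BT uw by (auto simp: is_subgraph_def simple_graph_def card_insert_if)
      moreover have "card (vertices T - vertices (attach B u w)) < card (vertices T - vertices B)"
        using uw simple_graphD(1)[OF sT] by (intro psubset_card_mono) auto
      moreover have "is_connected (attach B u w)"
        using less.prems(2) uw(1,2) by (rule connected_attach)
      moreover have "P (attach B u w)"
        using less.prems uw(1,4,2,3) by (rule step)
      ultimately show ?thesis by (intro less.hyps)
    qed
  qed
  then show ?thesis using A base by blast
qed

section \<open>Marginals and conditionally independent couplings\<close>

text \<open>The image of \<open>g\<close> under restriction to \<open>A\<close>, tested against
  every real function. Expectations of logarithms thus transfer directly, without sums over fibres
  or conditional probabilities.\<close>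

definition is_marginal ::
  "'b set \<Rightarrow> 'a set \<Rightarrow> 'a set \<Rightarrow> (('a \<Rightarrow> 'b) \<Rightarrow> real) \<Rightarrow> (('a \<Rightarrow> 'b) \<Rightarrow> real) \<Rightarrow> bool" where
  "is_marginal N A B f g \<longleftrightarrow> (\<forall>F :: ('a \<Rightarrow> 'b) \<Rightarrow> real.
     (\<Sum>\<phi>\<in>B \<rightarrow>\<^sub>E N. g \<phi> * F (restrict \<phi> A)) = (\<Sum>\<psi>\<in>A \<rightarrow>\<^sub>E N. f \<psi> * F \<psi>))"

lemma is_marginalD:
  "is_marginal N A B f g \<Longrightarrow>
    (\<Sum>\<phi>\<in>B \<rightarrow>\<^sub>E N. g \<phi> * F (restrict \<phi> A)) = (\<Sum>\<psi>\<in>A \<rightarrow>\<^sub>E N. f \<psi> * F \<psi>)"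
  by (simp add: is_marginal_def)

lemma is_marginal_sum:
  "is_marginal N A B f g \<Longrightarrow> sum g (B \<rightarrow>\<^sub>E N) = sum f (A \<rightarrow>\<^sub>E N)"
  using is_marginalD[of N A B f g "\<lambda>_. 1"] by simp

lemma is_marginal_refl: "is_marginal N A A f f"
  unfolding is_marginal_def by (intro allI sum.cong refl) (simp add: PiE_restrict)

lemma is_marginal_trans:
  fixes f g h :: "('a \<Rightarrow> 'b) \<Rightarrow> real"
  assumes "is_marginal N A B f g" "is_marginal N B C g h" "A \<subseteq> B"
  shows "is_marginal N A C f h"
  unfolding is_marginal_def
proof
  fix F :: "('a \<Rightarrow> 'b) \<Rightarrow> real"
  have "B \<inter> A = A" using assms(3) by blast
  then show "(\<Sum>\<phi>\<in>C \<rightarrow>\<^sub>E N. h \<phi> * F (restrict \<phi> A)) = (\<Sum>\<psi>\<in>A \<rightarrow>\<^sub>E N. f \<psi> * F \<psi>)"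
    using is_marginalD[OF assms(2), of "\<lambda>\<phi>. F (restrict \<phi> A)"] is_marginalD[OF assms(1), of F]
    by (simp add: restrict_restrict)
qed

lemma restrict_PiE_mono: "\<phi> \<in> B \<rightarrow>\<^sub>E N \<Longrightarrow> A \<subseteq> B \<Longrightarrow> restrict \<phi> A \<in> A \<rightarrow>\<^sub>E N"
  by auto

text \<open>Tested against the indicator of \<open>restrict \<phi> A\<close>, the marginal property
  writes \<open>f (restrict \<phi> A)\<close> as a sum of nonnegative terms, one of which is
  \<open>g \<phi>\<close>.\<close>

lemma marginal_pos:
  fixes f g :: "('a \<Rightarrow> 'b) \<Rightarrow> real"
  assumes "is_marginal N A B f g" "finite N" "finite B" "A \<subseteq> B"
    and nonneg: "\<And>\<phi>. \<phi> \<in> B \<rightarrow>\<^sub>E N \<Longrightarrow> 0 \<le> g \<phi>"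
    and \<phi>: "\<phi> \<in> B \<rightarrow>\<^sub>E N" "0 < g \<phi>"
  shows "0 < f (restrict \<phi> A)"
proof -
  let ?F = "\<lambda>\<psi>. of_bool (\<psi> = restrict \<phi> A) :: real"
  have fin: "finite (A \<rightarrow>\<^sub>E N)" "finite (B \<rightarrow>\<^sub>E N)"
    using assms finite_subset by (blast intro: finite_PiE)+
  have "g \<phi> \<le> (\<Sum>\<chi>\<in>B \<rightarrow>\<^sub>E N. g \<chi> * ?F (restrict \<chi> A))"
    using member_le_sum[OF \<phi>(1), of "\<lambda>\<chi>. g \<chi> * ?F (restrict \<chi> A)"] fin nonneg by simp
  also have "\<dots> = (\<Sum>\<psi>\<in>A \<rightarrow>\<^sub>E N. f \<psi> * ?F \<psi>)"
    by (rule is_marginalD) fact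
  also have "\<dots> = f (restrict \<phi> A)"
    using fin restrict_PiE_mono[OF \<phi>(1) assms(4)] by (simp add: of_bool_def if_distrib sum.delta' cong: if_cong)
  finally show ?thesis using \<phi>(2) by linarith
qed

definition marginal :: "'b set \<Rightarrow> 'a set \<Rightarrow> 'a set \<Rightarrow> (('a \<Rightarrow> 'b) \<Rightarrow> real) \<Rightarrow> ('a \<Rightarrow> 'b) \<Rightarrow> real" where
  "marginal N A B g \<sigma> = (\<Sum>\<phi>\<in>B \<rightarrow>\<^sub>E N. g \<phi> * of_bool (restrict \<phi> A = \<sigma>))"

lemma is_marginal_marginal:
  fixes g :: "('a \<Rightarrow> 'b) \<Rightarrow> real"
  assumes "finite N" "finite B" "A \<subseteq> B"
  shows "is_marginal N A B (marginal N A B g) g"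
  unfolding is_marginal_def
proof
  fix F :: "('a \<Rightarrow> 'b) \<Rightarrow> real"
  have fin: "finite (A \<rightarrow>\<^sub>E N)"
    using assms finite_subset by (blast intro: finite_PiE)
  have "(\<Sum>\<psi>\<in>A \<rightarrow>\<^sub>E N. marginal N A B g \<psi> * F \<psi>)
      = (\<Sum>\<phi>\<in>B \<rightarrow>\<^sub>E N. \<Sum>\<psi>\<in>A \<rightarrow>\<^sub>E N. g \<phi> * of_bool (restrict \<phi> A = \<psi>) * F \<psi>)"
    unfolding marginal_def sum_distrib_right by (rule sum.swap)
  also have "\<dots> = (\<Sum>\<phi>\<in>B \<rightarrow>\<^sub>E N. g \<phi> * F (restrict \<phi> A))"
  proof (rule sum.cong[OF refl])
    fix \<phi> assume "\<phi> \<in> B \<rightarrow>\<^sub>E N"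
    then have "restrict \<phi> A \<in> A \<rightarrow>\<^sub>E N" using assms(3) by (rule restrict_PiE_mono)
    then show "(\<Sum>\<psi>\<in>A \<rightarrow>\<^sub>E N. g \<phi> * of_bool (restrict \<phi> A = \<psi>) * F \<psi>) = g \<phi> * F (restrict \<phi> A)"
      using fin by (simp add: of_bool_def if_distrib if_distribR sum.delta cong: if_cong)
  qed
  finally show "(\<Sum>\<phi>\<in>B \<rightarrow>\<^sub>E N. g \<phi> * F (restrict \<phi> A))
      = (\<Sum>\<psi>\<in>A \<rightarrow>\<^sub>E N. marginal N A B g \<psi> * F \<psi>)" by simp
qed

lemma marginal_nonneg:
  "(\<And>\<phi>. \<phi> \<in> B \<rightarrow>\<^sub>E N \<Longrightarrow> 0 \<le> g \<phi>) \<Longrightarrow> 0 \<le> marginal N A B g \<sigma>"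
  unfolding marginal_def by (intro sum_nonneg) auto

section \<open>Conditionally independent gluing and its entropy\<close>

lemma sum_PiE_Un:
  fixes h :: "('a \<Rightarrow> 'b) \<Rightarrow> ('a \<Rightarrow> 'b) \<Rightarrow> real"
  assumes "finite N" "finite A" "finite B"
  shows "(\<Sum>\<phi>\<in>(A \<union> B) \<rightarrow>\<^sub>E N. h (restrict \<phi> A) (restrict \<phi> B))
    = (\<Sum>\<psi>\<in>A \<rightarrow>\<^sub>E N. \<Sum>\<chi>\<in>B \<rightarrow>\<^sub>E N.
        h \<psi> \<chi> * of_bool (restrict \<chi> (A \<inter> B) = restrict \<psi> (A \<inter> B)))"
proof -
  let ?R = "{(\<psi>, \<chi>) \<in> (A \<rightarrow>\<^sub>E N) \<times> (B \<rightarrow>\<^sub>E N). restrict \<chi> (A \<inter> B) = restrict \<psi> (A \<inter> B)}"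
  have fin: "finite (A \<rightarrow>\<^sub>E N)" "finite (B \<rightarrow>\<^sub>E N)"
    using assms by (auto intro: finite_PiE)
  have "(\<Sum>\<phi>\<in>(A \<union> B) \<rightarrow>\<^sub>E N. h (restrict \<phi> A) (restrict \<phi> B)) = (\<Sum>(\<psi>, \<chi>)\<in>?R. h \<psi> \<chi>)"
  proof (rule sum.reindex_bij_witness[where i = "\<lambda>(\<psi>, \<chi>) x. if x \<in> A then \<psi> x else \<chi> x"
        and j = "\<lambda>\<phi>. (restrict \<phi> A, restrict \<phi> B)"])
    fix \<phi> assume \<phi>: "\<phi> \<in> (A \<union> B) \<rightarrow>\<^sub>E N"
    then show "(case (restrict \<phi> A, restrict \<phi> B) of (\<psi>, \<chi>) \<Rightarrow> \<lambda>x. if x \<in> A then \<psi> x else \<chi> x) = \<phi>"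
      by (auto simp: fun_eq_iff restrict_def PiE_def extensional_def)
    have "A \<inter> B \<inter> A = A \<inter> B" "A \<inter> B \<inter> B = A \<inter> B" by auto
    with \<phi> show "(restrict \<phi> A, restrict \<phi> B) \<in> ?R"
      by (auto simp: restrict_restrict Int_ac)
  next
    fix \<pi> assume \<pi>: "\<pi> \<in> ?R"
    obtain \<psi> \<chi> where pi: "\<pi> = (\<psi>, \<chi>)" by force
    have agree: "\<psi> x = \<chi> x" if "x \<in> A" "x \<in> B" for x
    proof -
      have "restrict \<chi> (A \<inter> B) x = restrict \<psi> (A \<inter> B) x" using \<pi> pi by simp
      with that show ?thesis by simp
    qed
    have mem: "\<psi> \<in> A \<rightarrow>\<^sub>E N" "\<chi> \<in> B \<rightarrow>\<^sub>E N" using \<pi> pi by auto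
    show "(case \<pi> of (\<psi>, \<chi>) \<Rightarrow> \<lambda>x. if x \<in> A then \<psi> x else \<chi> x) \<in> (A \<union> B) \<rightarrow>\<^sub>E N"
      using mem by (auto simp: pi PiE_def extensional_def)
    show "(restrict (case \<pi> of (\<psi>, \<chi>) \<Rightarrow> \<lambda>x. if x \<in> A then \<psi> x else \<chi> x) A,
        restrict (case \<pi> of (\<psi>, \<chi>) \<Rightarrow> \<lambda>x. if x \<in> A then \<psi> x else \<chi> x) B) = \<pi>"
      using mem agree by (auto simp: pi fun_eq_iff restrict_def PiE_def extensional_def)
  qed simp
  also have "\<dots> = (\<Sum>(\<psi>, \<chi>)\<in>(A \<rightarrow>\<^sub>E N) \<times> (B \<rightarrow>\<^sub>E N).
      h \<psi> \<chi> * of_bool (restrict \<chi> (A \<inter> B) = restrict \<psi> (A \<inter> B)))"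
    using fin by (intro sum.mono_neutral_cong_left) auto
  finally show ?thesis by (simp add: sum.cartesian_product)
qed

text \<open>The law of two maps that are independent given their common restriction,
  \<open>m\<close> being the law of that restriction. If \<open>f\<close> and \<open>g\<close> are
  nonnegative with marginal \<open>m\<close>, they vanish wherever \<open>m\<close> does, so the
  convention for division by zero loses no mass.\<close>

definition glue :: "'a set \<Rightarrow> 'a set \<Rightarrow> (('a \<Rightarrow> 'b) \<Rightarrow> real) \<Rightarrow> (('a \<Rightarrow> 'b) \<Rightarrow> real) \<Rightarrow>
    (('a \<Rightarrow> 'b) \<Rightarrow> real) \<Rightarrow> ('a \<Rightarrow> 'b) \<Rightarrow> real" where
  "glue A B m f g \<phi> = f (restrict \<phi> A) * g (restrict \<phi> B) / m (restrict \<phi> (A \<inter> B))"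

lemma glue_commute: "glue A B m f g = glue B A m g f"
  by (simp add: glue_def fun_eq_iff Int_commute mult.commute)

text \<open>For a fixed map \<psi> on \<open>A\<close>, the \<open>g\<close>-mass of the maps on
  \<open>B\<close> that agree with \<psi> on the overlap is the value of \<open>m\<close> there,
  which cancels the denominator.\<close>

lemma is_marginal_glue1:
  fixes f g m :: "('a \<Rightarrow> 'b) \<Rightarrow> real"
  assumes fin: "finite N" "finite A" "finite B"
    and f: "is_marginal N (A \<inter> B) A m f" "\<And>\<phi>. \<phi> \<in> A \<rightarrow>\<^sub>E N \<Longrightarrow> 0 \<le> f \<phi>"
    and g: "is_marginal N (A \<inter> B) B m g"
  shows "is_marginal N A (A \<union> B) f (glue A B m f g)"
  unfolding is_marginal_def
proof
  fix F :: "('a \<Rightarrow> 'b) \<Rightarrow> real"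
  let ?S = "A \<inter> B"
  have AS: "A \<inter> ?S = ?S" by blast
  have "(\<Sum>\<phi>\<in>(A \<union> B) \<rightarrow>\<^sub>E N. glue A B m f g \<phi> * F (restrict \<phi> A))
      = (\<Sum>\<phi>\<in>(A \<union> B) \<rightarrow>\<^sub>E N. (\<lambda>\<psi> \<chi>. f \<psi> * g \<chi> / m (restrict \<psi> ?S) * F \<psi>) (restrict \<phi> A) (restrict \<phi> B))"
    by (simp add: glue_def restrict_restrict AS)
  also have "\<dots> = (\<Sum>\<psi>\<in>A \<rightarrow>\<^sub>E N. \<Sum>\<chi>\<in>B \<rightarrow>\<^sub>E N. f \<psi> * g \<chi> / m (restrict \<psi> ?S) * F \<psi> *
      of_bool (restrict \<chi> ?S = restrict \<psi> ?S))"
    by (rule sum_PiE_Un) fact+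
  also have "\<dots> = (\<Sum>\<psi>\<in>A \<rightarrow>\<^sub>E N. f \<psi> * F \<psi>)"
  proof (rule sum.cong[OF refl])
    fix \<psi> assume \<psi>: "\<psi> \<in> A \<rightarrow>\<^sub>E N"
    let ?\<sigma> = "restrict \<psi> ?S"
    have "?\<sigma> \<in> ?S \<rightarrow>\<^sub>E N" using \<psi> by (rule restrict_PiE_mono) blast
    moreover have "finite (?S \<rightarrow>\<^sub>E N)" using fin by (auto intro: finite_PiE)
    ultimately have "m ?\<sigma> = (\<Sum>\<tau>\<in>?S \<rightarrow>\<^sub>E N. m \<tau> * of_bool (\<tau> = ?\<sigma>))"
      by (simp add: of_bool_def if_distrib sum.delta' cong: if_cong)
    also have "\<dots> = (\<Sum>\<chi>\<in>B \<rightarrow>\<^sub>E N. g \<chi> * of_bool (restrict \<chi> ?S = ?\<sigma>))"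
      by (rule is_marginalD[OF g, symmetric])
    finally have m: "m ?\<sigma> = (\<Sum>\<chi>\<in>B \<rightarrow>\<^sub>E N. g \<chi> * of_bool (restrict \<chi> ?S = ?\<sigma>))" .
    have "(\<Sum>\<chi>\<in>B \<rightarrow>\<^sub>E N. f \<psi> * g \<chi> / m ?\<sigma> * F \<psi> * of_bool (restrict \<chi> ?S = ?\<sigma>))
        = f \<psi> * F \<psi> / m ?\<sigma> * (\<Sum>\<chi>\<in>B \<rightarrow>\<^sub>E N. g \<chi> * of_bool (restrict \<chi> ?S = ?\<sigma>))"
      unfolding sum_distrib_left by (rule sum.cong) simp_all
    also have "\<dots> = f \<psi> * F \<psi> / m ?\<sigma> * m ?\<sigma>"
      unfolding m ..
    finally have "(\<Sum>\<chi>\<in>B \<rightarrow>\<^sub>E N. f \<psi> * g \<chi> / m ?\<sigma> * F \<psi> * of_bool (restrict \<chi> ?S = ?\<sigma>))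
        = f \<psi> * F \<psi> / m ?\<sigma> * m ?\<sigma>" .
    \<comment> \<open>Cancelling \<open>m\<close> needs a nonzero value; in the remaining case both
      sides are 0.\<close>
    moreover have "f \<psi> = 0 \<or> 0 < m ?\<sigma>"
      using marginal_pos[OF f(1), of \<psi>] fin f(2) \<psi> by (cases "f \<psi> = 0") (auto simp: order_less_le)
    ultimately show "(\<Sum>\<chi>\<in>B \<rightarrow>\<^sub>E N. f \<psi> * g \<chi> / m ?\<sigma> * F \<psi> * of_bool (restrict \<chi> ?S = ?\<sigma>))
        = f \<psi> * F \<psi>"
      by auto
  qed
  finally show "(\<Sum>\<phi>\<in>(A \<union> B) \<rightarrow>\<^sub>E N. glue A B m f g \<phi> * F (restrict \<phi> A))
      = (\<Sum>\<psi>\<in>A \<rightarrow>\<^sub>E N. f \<psi> * F \<psi>)" .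
qed

lemma is_marginal_glue2:
  fixes f g m :: "('a \<Rightarrow> 'b) \<Rightarrow> real"
  assumes "finite N" "finite A" "finite B"
    and "is_marginal N (A \<inter> B) A m f"
    and "is_marginal N (A \<inter> B) B m g" "\<And>\<phi>. \<phi> \<in> B \<rightarrow>\<^sub>E N \<Longrightarrow> 0 \<le> g \<phi>"
  shows "is_marginal N B (A \<union> B) g (glue A B m f g)"
  using is_marginal_glue1[of N B A m g f] assms
  by (simp add: glue_commute Int_commute Un_commute)

text \<open>The logarithm of the quotient splits wherever the glued law is nonzero, and each of the
  three terms depends on one restriction only, so it can be averaged over the corresponding
  marginal.\<close>

lemma glue_log_sum:
  fixes f g m :: "('a \<Rightarrow> 'b) \<Rightarrow> real"
  assumes fin: "finite N" "finite A" "finite B"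
    and f: "is_marginal N (A \<inter> B) A m f" "\<And>\<phi>. \<phi> \<in> A \<rightarrow>\<^sub>E N \<Longrightarrow> 0 \<le> f \<phi>"
    and g: "is_marginal N (A \<inter> B) B m g" "\<And>\<phi>. \<phi> \<in> B \<rightarrow>\<^sub>E N \<Longrightarrow> 0 \<le> g \<phi>"
  shows "(\<Sum>\<phi>\<in>(A \<union> B) \<rightarrow>\<^sub>E N. glue A B m f g \<phi> * ln (glue A B m f g \<phi>))
    = (\<Sum>\<phi>\<in>A \<rightarrow>\<^sub>E N. f \<phi> * ln (f \<phi>)) + (\<Sum>\<phi>\<in>B \<rightarrow>\<^sub>E N. g \<phi> * ln (g \<phi>))
      - (\<Sum>\<sigma>\<in>(A \<inter> B) \<rightarrow>\<^sub>E N. m \<sigma> * ln (m \<sigma>))"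
proof -
  let ?h = "glue A B m f g"
  have mA: "is_marginal N A (A \<union> B) f ?h" and mB: "is_marginal N B (A \<union> B) g ?h"
    using is_marginal_glue1 is_marginal_glue2 assms by metis+
  have mS: "is_marginal N (A \<inter> B) (A \<union> B) m ?h"
    using is_marginal_trans[OF f(1) mA] by blast
  have "?h \<phi> * ln (?h \<phi>) = ?h \<phi> * ln (f (restrict \<phi> A)) + ?h \<phi> * ln (g (restrict \<phi> B))
      - ?h \<phi> * ln (m (restrict \<phi> (A \<inter> B)))" for \<phi>
  proof (cases "?h \<phi> = 0")
    case False
    then have "f (restrict \<phi> A) \<noteq> 0" "g (restrict \<phi> B) \<noteq> 0" "m (restrict \<phi> (A \<inter> B)) \<noteq> 0"
      by (auto simp: glue_def)
    then have "ln (?h \<phi>) = ln (f (restrict \<phi> A)) + ln (g (restrict \<phi> B)) - ln (m (restrict \<phi> (A \<inter> B)))"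
      by (simp add: glue_def ln_mult ln_div)
    then show ?thesis by (simp only: distrib_left right_diff_distrib)
  qed simp
  then show ?thesis
    using is_marginalD[OF mA, of "\<lambda>\<phi>. ln (f \<phi>)"] is_marginalD[OF mB, of "\<lambda>\<phi>. ln (g \<phi>)"]
      is_marginalD[OF mS, of "\<lambda>\<phi>. ln (m \<phi>)"]
    by (simp add: sum.distrib sum_subtractf)
qed

section \<open>Gibbs' inequality\<close>

text \<open>Nonnegativity of relative entropy, termwise from ln t \<le> t - 1 at t = q/f. The
  support condition \<open>ac\<close> excludes points with \<open>q x = 0 < f x\<close>, where the
  default \<open>ln 0 = 0\<close> would replace minus infinity.\<close>

lemma gibbs_inequality:
  fixes f q :: "'c \<Rightarrow> real"
  assumes f: "\<And>x. x \<in> \<Omega> \<Longrightarrow> 0 \<le> f x" and q: "\<And>x. x \<in> \<Omega> \<Longrightarrow> 0 \<le> q x"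
    and ac: "\<And>x. x \<in> \<Omega> \<Longrightarrow> 0 < f x \<Longrightarrow> 0 < q x"
    and le: "sum q \<Omega> \<le> sum f \<Omega>"
  shows "(\<Sum>x\<in>\<Omega>. f x * ln (q x)) \<le> (\<Sum>x\<in>\<Omega>. f x * ln (f x))"
proof -
  have "f x * ln (q x) - f x * ln (f x) \<le> q x - f x" if x: "x \<in> \<Omega>" for x
  proof (cases "f x = 0")
    case False
    then have pos: "0 < f x" "0 < q x" using f[OF x] ac[OF x] by auto
    have "ln (q x / f x) \<le> q x / f x - 1"
      using pos by (intro ln_le_minus_one) simp
    then have "f x * ln (q x / f x) \<le> f x * (q x / f x - 1)"
      using pos by (intro mult_left_mono) auto
    then show ?thesis using pos by (simp add: ln_div algebra_simps)
  qed (use q[OF x] in simp)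
  then have "(\<Sum>x\<in>\<Omega>. f x * ln (q x) - f x * ln (f x)) \<le> (\<Sum>x\<in>\<Omega>. q x - f x)"
    by (rule sum_mono)
  then show ?thesis using le by (simp add: sum_subtractf)
qed

text \<open>Gibbs' inequality against the uniform law on \<open>A\<close>. Positivity of
  \<open>card A\<close> is recorded because passing from logarithms back to cardinalities requires
  it.\<close>

lemma entropy_le_ln_card:
  fixes f :: "'c \<Rightarrow> real"
  assumes "finite \<Omega>" "\<And>x. x \<in> \<Omega> \<Longrightarrow> 0 \<le> f x" "sum f \<Omega> = 1"
    and A: "A \<subseteq> \<Omega>" "\<And>x. x \<in> \<Omega> \<Longrightarrow> 0 < f x \<Longrightarrow> x \<in> A"
  shows "- (\<Sum>x\<in>\<Omega>. f x * ln (f x)) \<le> ln (card A)" "0 < card A"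
proof -
  have finA: "finite A" using A(1) assms(1) finite_subset by blast
  have "A \<noteq> {}"
  proof
    assume "A = {}"
    then have "f x \<le> 0" if "x \<in> \<Omega>" for x using A(2)[OF that] by fastforce
    then have "sum f \<Omega> \<le> 0" by (rule sum_nonpos)
    then show False using assms(3) by simp
  qed
  then show pos: "0 < card A" using finA by (simp add: card_gt_0_iff)
  let ?q = "\<lambda>x. of_bool (x \<in> A) / real (card A)"
  have "sum ?q \<Omega> = (\<Sum>x\<in>A. 1 / real (card A))"
    using assms(1) A(1) by (intro sum.mono_neutral_cong_right) simp_all
  also have "\<dots> = 1" using pos by simp
  finally have sum_q: "sum ?q \<Omega> = 1" .
  have "(\<Sum>x\<in>\<Omega>. f x * ln (?q x)) \<le> (\<Sum>x\<in>\<Omega>. f x * ln (f x))"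
  proof (rule gibbs_inequality)
    show "0 < ?q x" if "x \<in> \<Omega>" "0 < f x" for x
      using A(2)[OF that] pos by simp
    show "sum ?q \<Omega> \<le> sum f \<Omega>" by (simp only: sum_q assms(3))
  qed (use assms(2) in simp_all)
  moreover have "(\<Sum>x\<in>\<Omega>. f x * ln (?q x)) = (\<Sum>x\<in>\<Omega>. f x * - ln (card A))"
  proof (rule sum.cong[OF refl])
    fix x assume x: "x \<in> \<Omega>"
    show "f x * ln (?q x) = f x * - ln (card A)"
    proof (cases "f x = 0")
      case False
      then have "x \<in> A" using assms(2)[OF x] A(2)[OF x] by simp
      then show ?thesis using pos by (simp add: ln_div)
    qed simp
  qed
  moreover have "(\<Sum>x\<in>\<Omega>. f x * - ln (card A)) = - ln (card A)"
    using assms(3) by (simp only: flip: sum_distrib_right)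
  ultimately show "- (\<Sum>x\<in>\<Omega>. f x * ln (f x)) \<le> ln (card A)"
    by linarith
qed

section \<open>Maps extended by one point, and nested marginals\<close>

lemma sum_PiE_insert:
  assumes "w \<notin> A"
  shows "(\<Sum>\<phi>\<in>insert w A \<rightarrow>\<^sub>E N. f \<phi>) = (\<Sum>\<phi>\<in>A \<rightarrow>\<^sub>E N. \<Sum>y\<in>N. f (\<phi>(w := y)))"
proof -
  have "(\<Sum>\<phi>\<in>insert w A \<rightarrow>\<^sub>E N. f \<phi>) = (\<Sum>(y, \<phi>)\<in>N \<times> (A \<rightarrow>\<^sub>E N). f (\<phi>(w := y)))"
    using inj_combinator[OF assms, of "\<lambda>_. N"]
    by (simp add: PiE_insert_eq sum.reindex case_prod_unfold)
  also have "\<dots> = (\<Sum>y\<in>N. \<Sum>\<phi>\<in>A \<rightarrow>\<^sub>E N. f (\<phi>(w := y)))"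
    by (simp add: sum.cartesian_product)
  also have "\<dots> = (\<Sum>\<phi>\<in>A \<rightarrow>\<^sub>E N. \<Sum>y\<in>N. f (\<phi>(w := y)))"
    by (rule sum.swap)
  finally show ?thesis .
qed

text \<open>Both laws are restrictions of the same \<open>h\<close>, and restricting from
  \<open>C\<close> to \<open>A\<close> may pass through \<open>B\<close>. This carries a law known
  on a set down from a tree to a subtree.\<close>

lemma is_marginal_between:
  fixes f g h :: "('a \<Rightarrow> 'b) \<Rightarrow> real"
  assumes "is_marginal N A C f h" "is_marginal N B C g h" "A \<subseteq> B"
  shows "is_marginal N A B f g"
  unfolding is_marginal_def
proof
  fix F :: "('a \<Rightarrow> 'b) \<Rightarrow> real"
  have "B \<inter> A = A" using assms(3) by blast
  then show "(\<Sum>\<phi>\<in>B \<rightarrow>\<^sub>E N. g \<phi> * F (restrict \<phi> A)) = (\<Sum>\<psi>\<in>A \<rightarrow>\<^sub>E N. f \<psi> * F \<psi>)"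
    using is_marginalD[OF assms(2), of "\<lambda>\<phi>. F (restrict \<phi> A)"] is_marginalD[OF assms(1), of F]
    by (simp add: restrict_restrict)
qed

section \<open>Branching random walks in the host graph\<close>

text \<open>
  The law of a tree-indexed stationary random walk, written as a product over vertices and edges,
  visibly does not depend on the vertex where the walk starts, and it restricts to the law of every
  subtree. The set \<open>I\<close> holds the non-isolated vertices of the source graph; the others are
  mapped uniformly, because a stationary image would have too little entropy.
\<close>

locale host_graph =
  fixes G :: "'b sgraph"
  assumes simple_G: "simple_graph G" and edges_G: "edges G \<noteq> {}"
begin

definition stationary :: "'b \<Rightarrow> real" where
  "stationary x = real (card {y \<in> vertices G. {x, y} \<in> edges G}) / (2 * real (card (edges G)))"

text \<open>The density of a uniformly random directed edge, of mass 1/(2m) each, with respect to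
  the product of two stationary laws. That it depends on the unordered edge only is the
  reversibility of the walk.\<close>

definition edge_weight :: "'b set \<Rightarrow> real" where
  "edge_weight e = of_bool (e \<in> edges G) / (2 * real (card (edges G)) * (\<Prod>x\<in>e. stationary x))"

text \<open>Membership in \<open>I\<close> is decided in the whole source graph, not in a bag: the
  vertex of a one-vertex bag may have edges in other bags, and its laws there must agree.\<close>

definition vertex_law :: "'a set \<Rightarrow> 'a \<Rightarrow> 'b \<Rightarrow> real" where
  "vertex_law I v x = (if v \<in> I then stationary x else 1 / real (card (vertices G)))"

definition tree_law :: "'a set \<Rightarrow> 'a sgraph \<Rightarrow> ('a \<Rightarrow> 'b) \<Rightarrow> real" where
  "tree_law I T \<phi> = (\<Prod>v\<in>vertices T. vertex_law I v (\<phi> v)) * (\<Prod>e\<in>edges T. edge_weight (\<phi> ` e))"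

lemmas host = simple_graphD[OF simple_G]

lemma card_edges_G_pos: "0 < card (edges G)"
  using host(2) edges_G by (simp add: card_gt_0_iff)

lemma card_vertices_G_pos: "0 < card (vertices G)"
proof -
  obtain e where "e \<in> edges G" using edges_G by blast
  then have "e \<noteq> {}" "e \<subseteq> vertices G" using host(4,5) by fastforce+
  then show ?thesis using host(1) by (auto simp: card_gt_0_iff)
qed

lemma stationary_nonneg: "0 \<le> stationary x"
  by (simp add: stationary_def)

lemma stationary_pos: "{x, y} \<in> edges G \<Longrightarrow> 0 < stationary x"
proof -
  assume xy: "{x, y} \<in> edges G"
  then have "y \<in> {y \<in> vertices G. {x, y} \<in> edges G}" using host(6)[OF xy] by simp
  then have "0 < card {y \<in> vertices G. {x, y} \<in> edges G}"
    using host(1) by (subst card_gt_0_iff) auto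
  then show ?thesis using card_edges_G_pos by (simp add: stationary_def)
qed

text \<open>Handshaking: the neighbours of a point correspond to the edges through it, and every
  edge has two ends.\<close>

lemma sum_stationary: "sum stationary (vertices G) = 1"
proof -
  have "card {y \<in> vertices G. {x, y} \<in> edges G} = card {e \<in> edges G. x \<in> e}" for x
  proof (rule bij_betw_same_card[where f = "\<lambda>y. {x, y}"])
    show "bij_betw (\<lambda>y. {x, y}) {y \<in> vertices G. {x, y} \<in> edges G} {e \<in> edges G. x \<in> e}"
    proof (intro bij_betw_imageI inj_onI subset_antisym subsetI)
      fix e assume e: "e \<in> {e \<in> edges G. x \<in> e}"
      then obtain y where "e = {x, y}"
        using host(4)[of e] by (auto simp: card_2_iff)
      with e show "e \<in> (\<lambda>y. {x, y}) ` {y \<in> vertices G. {x, y} \<in> edges G}"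
        using host(5)[of e] by blast
    qed (auto simp: doubleton_eq_iff)
  qed
  moreover have "(\<Sum>x\<in>vertices G. card {e \<in> edges G. x \<in> e}) = (\<Sum>e\<in>edges G. 2)"
  proof (rule sum_multicount_gen[OF host(1,2)], intro ballI)
    fix e assume e: "e \<in> edges G"
    then have "{x \<in> vertices G. x \<in> e} = e" using host(5) by blast
    then show "card {x \<in> vertices G. x \<in> e} = 2" using host(4)[OF e] by simp
  qed
  ultimately have "(\<Sum>x\<in>vertices G. real (card {y \<in> vertices G. {x, y} \<in> edges G}))
      = 2 * real (card (edges G))"
    by (simp flip: of_nat_sum)
  then show ?thesis
    using card_edges_G_pos by (simp add: stationary_def flip: sum_divide_distrib)
qed

lemma edge_weight_nonneg: "0 \<le> edge_weight e"
  by (simp add: edge_weight_def stationary_nonneg prod_nonneg)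

lemma edge_weight_doubleton:
  "{x, y} \<in> edges G \<Longrightarrow>
    edge_weight {x, y} = 1 / (2 * real (card (edges G)) * (stationary x * stationary y))"
  using host(6)[of x y] by (simp add: edge_weight_def)

text \<open>The summand is the transition probability from \<open>x\<close> to \<open>y\<close>: one
  over the degree of \<open>x\<close> if they are adjacent, and 0 otherwise.\<close>

lemma sum_neighbours:
  assumes "0 < stationary x"
  shows "(\<Sum>y\<in>vertices G. stationary y * edge_weight {x, y}) = 1"
proof -
  let ?m = "2 * real (card (edges G))"
  have "stationary y * edge_weight {x, y} = of_bool ({x, y} \<in> edges G) / (?m * stationary x)" for y
  proof (cases "{x, y} \<in> edges G")
    case True
    then have "0 < stationary y" using stationary_pos[of y x] by (simp add: insert_commute)
    then show ?thesis using True by (simp add: edge_weight_doubleton)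
  qed (simp add: edge_weight_def)
  then have "(\<Sum>y\<in>vertices G. stationary y * edge_weight {x, y})
      = (\<Sum>y\<in>vertices G. of_bool ({x, y} \<in> edges G)) / (?m * stationary x)"
    by (simp add: sum_divide_distrib)
  also have "(\<Sum>y\<in>vertices G. of_bool ({x, y} \<in> edges G)) = ?m * stationary x"
    using host(1) card_edges_G_pos by (simp add: stationary_def Int_def)
  finally show ?thesis using assms card_edges_G_pos by simp
qed

lemma vertex_law_nonneg: "0 \<le> vertex_law I v x"
  by (simp add: vertex_law_def stationary_nonneg)

lemma sum_vertex_law: "sum (vertex_law I v) (vertices G) = 1"
  using sum_stationary card_vertices_G_pos by (cases "v \<in> I") (simp_all add: vertex_law_def)

lemma tree_law_nonneg: "0 \<le> tree_law I T \<phi>"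
  by (simp add: tree_law_def prod_nonneg vertex_law_nonneg edge_weight_nonneg)

lemma tree_law_attach:
  assumes "simple_graph B" "u \<in> vertices B" "w \<notin> vertices B" "w \<in> I"
  shows "tree_law I (attach B u w) (\<phi>(w := y))
    = tree_law I B \<phi> * (stationary y * edge_weight {\<phi> u, y})"
proof -
  note B = simple_graphD[OF assms(1)]
  have "{u, w} \<notin> edges B" using B(6) assms(3) by blast
  moreover have "(\<Prod>v\<in>vertices B. vertex_law I v ((\<phi>(w := y)) v))
      = (\<Prod>v\<in>vertices B. vertex_law I v (\<phi> v))"
    using assms(3) by (intro prod.cong) auto
  moreover have "(\<Prod>e\<in>edges B. edge_weight (\<phi>(w := y) ` e)) = (\<Prod>e\<in>edges B. edge_weight (\<phi> ` e))"
  proof (rule prod.cong[OF refl])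
    fix e assume "e \<in> edges B"
    then have "w \<notin> e" using B(5) assms(3) by blast
    then have "\<phi>(w := y) ` e = \<phi> ` e" by (intro image_cong) auto
    then show "edge_weight (\<phi>(w := y) ` e) = edge_weight (\<phi> ` e)" by (rule arg_cong)
  qed
  moreover have "\<phi>(w := y) ` {u, w} = {\<phi> u, y}"
    using assms(2,3) by auto
  ultimately show ?thesis
    using B(1,2) assms(3,4) by (simp add: tree_law_def vertex_law_def)
qed

lemma tree_law_attach_sum:
  assumes "simple_graph B" "u \<in> vertices B" "w \<notin> vertices B" "w \<in> I" "u \<in> I"
  shows "(\<Sum>y\<in>vertices G. tree_law I (attach B u w) (\<phi>(w := y))) = tree_law I B \<phi>"
proof (cases "stationary (\<phi> u) = 0")
  \<comment> \<open>At a point of degree 0 the transition weights sum to 0 instead of 1, but then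
    the vertex factor of \<open>u\<close> already makes the law of \<open>B\<close> vanish.\<close>
  case True
  then have "vertex_law I u (\<phi> u) = 0" using assms(5) by (simp add: vertex_law_def)
  then have "tree_law I B \<phi> = 0"
    using assms(2) simple_graphD(1)[OF assms(1)] by (auto simp: tree_law_def)
  then show ?thesis by (simp add: tree_law_attach assms)
next
  case False
  then have "0 < stationary (\<phi> u)" using stationary_nonneg[of "\<phi> u"] by simp
  then show ?thesis
    using sum_neighbours[of "\<phi> u"] by (simp add: tree_law_attach assms flip: sum_distrib_left)
qed

lemma is_marginal_attach:
  assumes "simple_graph B" "u \<in> vertices B" "w \<notin> vertices B" "w \<in> I" "u \<in> I"
  shows "is_marginal (vertices G) (vertices B) (insert w (vertices B))
    (tree_law I B) (tree_law I (attach B u w))"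
  unfolding is_marginal_def
proof
  fix F :: "('a \<Rightarrow> 'b) \<Rightarrow> real"
  let ?V = "vertices B" and ?N = "vertices G"
  have "restrict (\<phi>(w := y)) ?V = \<phi>" if "\<phi> \<in> ?V \<rightarrow>\<^sub>E ?N" for \<phi> y
    using that assms(3) by (simp add: restrict_upd PiE_restrict)
  then show "(\<Sum>\<phi>\<in>insert w ?V \<rightarrow>\<^sub>E ?N. tree_law I (attach B u w) \<phi> * F (restrict \<phi> ?V))
      = (\<Sum>\<psi>\<in>?V \<rightarrow>\<^sub>E ?N. tree_law I B \<psi> * F \<psi>)"
    by (simp add: sum_PiE_insert[OF assms(3)] tree_law_attach_sum[OF assms]
        flip: sum_distrib_right cong: sum.cong)
qed

text \<open>The vertices outside \<open>A\<close> are summed out as leaves, the induction starting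
  from \<open>A\<close>. Since the edges of \<open>T\<close> lie in \<open>I\<close>, each leaf and
  its neighbour carry stationary factors, so each sum is one over transition probabilities.\<close>

lemma tree_law_marginal:
  assumes T: "is_tree T" "\<Union>(edges T) \<subseteq> I" and A: "is_subgraph A T" "is_connected A"
  shows "is_marginal (vertices G) (vertices A) (vertices T) (tree_law I A) (tree_law I T)"
    and "vertices A \<subseteq> vertices T"
proof -
  have "vertices A \<subseteq> vertices T \<and>
      is_marginal (vertices G) (vertices A) (vertices T) (tree_law I A) (tree_law I T)"
    using T(1) A
  proof (induction rule: tree_induct)
    case base
    show ?case by (simp add: is_marginal_refl)
  next
    case (attach B u w)
    have "u \<in> I" "w \<in> I" using attach.hyps(6) T(2) by blast+
    then have "is_marginal (vertices G) (vertices B) (vertices (attach B u w))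
        (tree_law I B) (tree_law I (attach B u w))"
      using is_marginal_attach[of B u w I] attach by (simp add: is_subgraph_def)
    then show ?case
      using attach.IH is_marginal_trans by fastforce
  qed
  then show "is_marginal (vertices G) (vertices A) (vertices T) (tree_law I A) (tree_law I T)"
    "vertices A \<subseteq> vertices T" by blast+
qed

text \<open>The case of a one-vertex subtree: the law of a vertex does not depend on the tree
  containing it.\<close>

lemma tree_law_vertex_marginal:
  assumes "is_tree T" "\<Union>(edges T) \<subseteq> I" "v \<in> vertices T"
  shows "is_marginal (vertices G) {v} (vertices T) (\<lambda>\<phi>. vertex_law I v (\<phi> v)) (tree_law I T)"
proof -
  have "is_subgraph (SGraph {v} {}) T"
    using assms(3) by (simp add: is_subgraph_def simple_graph_def)
  from tree_law_marginal(1)[OF assms(1,2) this connected_singleton] show ?thesis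
    by (simp add: tree_law_def [abs_def])
qed

lemma vertex_marginalD:
  assumes "is_marginal (vertices G) {v} U (\<lambda>\<phi>. vertex_law I v (\<phi> v)) f"
  shows "(\<Sum>\<phi>\<in>U \<rightarrow>\<^sub>E vertices G. f \<phi> * F (\<phi> v)) = (\<Sum>x\<in>vertices G. vertex_law I v x * F x)"
  using is_marginalD[OF assms, of "\<lambda>\<phi>. F (\<phi> v)"]
  by (simp add: sum_PiE_insert[of v "{}"])

lemma sum_tree_law:
  assumes "is_tree T" "\<Union>(edges T) \<subseteq> I"
  shows "sum (tree_law I T) (vertices T \<rightarrow>\<^sub>E vertices G) = 1"
proof -
  obtain v where "v \<in> vertices T"
    using assms(1) by (auto simp: is_tree_def is_connected_def)
  from vertex_marginalD[OF tree_law_vertex_marginal[OF assms this], of "\<lambda>_. 1"]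
  show ?thesis by (simp add: sum_vertex_law)
qed

end

section \<open>The entropy of a tree-indexed walk\<close>

lemma connected_subgraph_is_tree:
  assumes "is_tree T" "is_subgraph B T" "is_connected B"
  shows "is_tree B"
proof -
  have "is_cycle T p" if "is_cycle B p" for p
    using that path_between_mono[of B "hd p" p "last p" T] assms(2)
    by (auto simp: is_cycle_def is_subgraph_def path_between_def)
  then show ?thesis
    using assms by (auto simp: is_tree_def is_subgraph_def)
qed

context host_graph begin

definition vertex_log :: "'a set \<Rightarrow> 'a \<Rightarrow> real" where
  "vertex_log I v = (\<Sum>x\<in>vertices G. vertex_law I v x * ln (vertex_law I v x))"

text \<open>In entropies this is 2h - ln (2m), the mutual information of the two ends of a random
  directed edge, whose joint entropy is ln (2m).\<close>

definition edge_log :: real where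
  "edge_log = - ln (2 * real (card (edges G))) - 2 * (\<Sum>x\<in>vertices G. stationary x * ln (stationary x))"

lemma vertex_log_mem: "v \<in> I \<Longrightarrow> vertex_log I v = (\<Sum>x\<in>vertices G. stationary x * ln (stationary x))"
  by (simp add: vertex_log_def vertex_law_def)

lemma vertex_log_not_mem: "v \<notin> I \<Longrightarrow> vertex_log I v = - ln (real (card (vertices G)))"
  using card_vertices_G_pos by (simp add: vertex_log_def vertex_law_def ln_div)

text \<open>A step from \<open>\<phi> u\<close> is uniform over the neighbours, so it lowers the
  logarithm of the law by ln (2m) + ln (stationary (\<phi> u)), whatever \<open>y\<close> is. The
  average of the last term is known because \<open>u\<close> has the stationary law.\<close>

lemma tree_law_log_attach:
  assumes B: "is_tree B" "\<Union>(edges B) \<subseteq> I" and uw: "u \<in> vertices B" "w \<notin> vertices B" "w \<in> I" "u \<in> I"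
  shows "(\<Sum>\<phi>\<in>insert w (vertices B) \<rightarrow>\<^sub>E vertices G.
      tree_law I (attach B u w) \<phi> * ln (tree_law I (attach B u w) \<phi>))
    = (\<Sum>\<phi>\<in>vertices B \<rightarrow>\<^sub>E vertices G. tree_law I B \<phi> * ln (tree_law I B \<phi>))
      + vertex_log I w + edge_log"
proof -
  let ?N = "vertices G" and ?V = "vertices B" and ?m = "2 * real (card (edges G))"
  let ?l = "tree_law I B" and ?l' = "tree_law I (attach B u w)"
  have sB: "simple_graph B" using B(1) by (simp add: is_tree_def)
  have step: "?l' (\<phi>(w := y)) * ln (?l' (\<phi>(w := y)))
      = ?l' (\<phi>(w := y)) * (ln (?l \<phi>) - ln ?m - ln (stationary (\<phi> u)))" for \<phi> y
  proof (cases "?l' (\<phi>(w := y)) = 0")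
    case False
    have l': "?l' (\<phi>(w := y)) = ?l \<phi> * (stationary y * edge_weight {\<phi> u, y})"
      by (rule tree_law_attach[OF sB uw(1-3)])
    have edge: "{\<phi> u, y} \<in> edges G"
      using False l' by (cases "{\<phi> u, y} \<in> edges G") (simp_all add: edge_weight_def)
    have pos: "0 < stationary (\<phi> u)" "0 < stationary y" "?l \<phi> \<noteq> 0" "0 < ?m"
      using stationary_pos[OF edge] stationary_pos[of y "\<phi> u"] edge False l' card_edges_G_pos
      by (auto simp: insert_commute)
    have "?l' (\<phi>(w := y)) = ?l \<phi> / (?m * stationary (\<phi> u))"
      using pos by (simp add: l' edge_weight_doubleton[OF edge])
    then have "ln (?l' (\<phi>(w := y))) = ln (?l \<phi>) - (ln ?m + ln (stationary (\<phi> u)))"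
      using pos by (simp only: ln_div ln_mult mult_eq_0_iff less_imp_neq[symmetric] simp_thms if_True)
    then show ?thesis by (simp only: diff_diff_eq)
  qed simp
  \<comment> \<open>The left side concerns \<open>u\<close>, the right side \<open>w\<close>: both
    lie in \<open>I\<close>, so their vertex terms coincide.\<close>
  have marg: "(\<Sum>\<phi>\<in>?V \<rightarrow>\<^sub>E ?N. ?l \<phi> * ln (stationary (\<phi> u))) = vertex_log I w"
    using vertex_marginalD[OF tree_law_vertex_marginal[OF B uw(1)], of "\<lambda>x. ln (stationary x)"] uw
    by (simp add: vertex_log_mem vertex_law_def)
  have "(\<Sum>\<phi>\<in>insert w ?V \<rightarrow>\<^sub>E ?N. ?l' \<phi> * ln (?l' \<phi>))
      = (\<Sum>\<phi>\<in>?V \<rightarrow>\<^sub>E ?N. \<Sum>y\<in>?N. ?l' (\<phi>(w := y)) * (ln (?l \<phi>) - ln ?m - ln (stationary (\<phi> u))))"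
    by (simp only: sum_PiE_insert[OF uw(2)] step)
  also have "\<dots> = (\<Sum>\<phi>\<in>?V \<rightarrow>\<^sub>E ?N. ?l \<phi> * (ln (?l \<phi>) - ln ?m - ln (stationary (\<phi> u))))"
    by (simp only: tree_law_attach_sum[OF sB uw] flip: sum_distrib_right)
  also have "\<dots> = (\<Sum>\<phi>\<in>?V \<rightarrow>\<^sub>E ?N. ?l \<phi> * ln (?l \<phi>)) - ln ?m * sum ?l (?V \<rightarrow>\<^sub>E ?N)
      - (\<Sum>\<phi>\<in>?V \<rightarrow>\<^sub>E ?N. ?l \<phi> * ln (stationary (\<phi> u)))"
    by (simp add: sum_subtractf right_diff_distrib sum_distrib_left mult.commute)
  also have "\<dots> = (\<Sum>\<phi>\<in>?V \<rightarrow>\<^sub>E ?N. ?l \<phi> * ln (?l \<phi>)) + vertex_log I w + edge_log"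
    using uw(3) by (simp add: marg sum_tree_law[OF B] edge_log_def vertex_log_mem)
  finally show ?thesis .
qed

lemma tree_law_log_sum:
  assumes T: "is_tree T" "\<Union>(edges T) \<subseteq> I"
  shows "(\<Sum>\<phi>\<in>vertices T \<rightarrow>\<^sub>E vertices G. tree_law I T \<phi> * ln (tree_law I T \<phi>))
    = (\<Sum>v\<in>vertices T. vertex_log I v) + real (card (edges T)) * edge_log"
proof -
  obtain v where v: "v \<in> vertices T"
    using T(1) by (auto simp: is_tree_def is_connected_def)
  have "is_subgraph (SGraph {v} {}) T"
    using v by (simp add: is_subgraph_def simple_graph_def)
  from T(1) this connected_singleton show ?thesis
  proof (induction rule: tree_induct)
    case base
    show ?case by (simp add: sum_PiE_insert[of v "{}"] tree_law_def vertex_log_def)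
  next
    case (attach B u w)
    have uw: "u \<in> I" "w \<in> I" using attach.hyps(6) T(2) by blast+
    have sB: "simple_graph B" "\<Union>(edges B) \<subseteq> I"
      using attach.hyps(1) T(2) by (auto simp: is_subgraph_def)
    have tB: "is_tree B" using connected_subgraph_is_tree[OF T(1) attach.hyps(1,2)] .
    have "{u, w} \<notin> edges B" using simple_graphD(6)[OF sB(1)] attach.hyps(5) by blast
    then show ?case
      using tree_law_log_attach[OF tB sB(2) attach.hyps(3,5) uw(2,1)] attach.IH
        attach.hyps(5) simple_graphD(1,2)[OF sB(1)]
      by (simp add: algebra_simps)
  qed
qed

end

section \<open>Gluing the laws of the bags\<close>

lemma isomorphism_edges:
  assumes f: "is_isomorphism f A B" and "simple_graph A" "simple_graph B"
  shows "bij_betw ((`) f) (edges A) (edges B)"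
proof (rule bij_betw_imageI)
  note A = simple_graphD[OF assms(2)] and B = simple_graphD[OF assms(3)]
  have bij: "inj_on f (vertices A)" "f ` vertices A = vertices B"
    using f by (auto simp: is_isomorphism_def bij_betw_def)
  have edge: "{f v, f w} \<in> edges B \<longleftrightarrow> {v, w} \<in> edges A" if "v \<in> vertices A" "w \<in> vertices A" for v w
    using f that by (auto simp: is_isomorphism_def)
  show "inj_on ((`) f) (edges A)"
    using bij(1) A(5) by (intro inj_onI) (metis inj_on_image_eq_iff)
  show "(`) f ` edges A = edges B"
  proof (intro subset_antisym subsetI)
    fix e assume "e \<in> (`) f ` edges A"
    then obtain d where d: "d \<in> edges A" "e = f ` d" by blast
    then obtain v w where vw: "d = {v, w}" using A(4)[of d] by (auto simp: card_2_iff)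
    then show "e \<in> edges B" using edge[of v w] A(5)[OF d(1)] d by auto
  next
    fix e assume e: "e \<in> edges B"
    then obtain v' w' where vw': "e = {v', w'}" using B(4)[of e] by (auto simp: card_2_iff)
    then have "v' \<in> f ` vertices A" "w' \<in> f ` vertices A" using B(5)[OF e] bij(2) by auto
    then obtain v w where vw: "v \<in> vertices A" "w \<in> vertices A" "v' = f v" "w' = f w" by blast
    then have "{v, w} \<in> edges A" "e = f ` {v, w}" using edge e vw' by auto
    then show "e \<in> (`) f ` edges A" by blast
  qed
qed

context host_graph begin

text \<open>Relabelling along \<open>f\<close> turns one product into the other. The only ingredient
  that the isomorphism does not preserve by itself is membership in \<open>I\<close>, hence the
  assumption on it.\<close>

lemma tree_law_marginal_isomorphism:
  assumes f: "is_isomorphism f A B" "simple_graph A" "simple_graph B"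
    and I: "\<And>v. v \<in> vertices A \<Longrightarrow> f v \<in> I \<longleftrightarrow> v \<in> I"
    and S: "S \<subseteq> vertices A" "\<And>v. v \<in> S \<Longrightarrow> f v = v"
    and m: "is_marginal (vertices G) S (vertices A) m (tree_law I A)"
  shows "is_marginal (vertices G) S (vertices B) m (tree_law I B)"
  unfolding is_marginal_def
proof
  fix F :: "('a \<Rightarrow> 'b) \<Rightarrow> real"
  let ?N = "vertices G" and ?VA = "vertices A" and ?VB = "vertices B"
  have bij: "bij_betw f ?VA ?VB" using f(1) by (simp add: is_isomorphism_def)
  let ?g = "inv_into ?VA f"
  have g: "?g w \<in> ?VA" "f (?g w) = w" if "w \<in> ?VB" for w
    using that bij by (auto simp: bij_betw_def inv_into_into f_inv_into_f)
  have fVB: "f v \<in> ?VB" "?g (f v) = v" if "v \<in> ?VA" for v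
    using that bij by (auto simp: bij_betw_def)
  have SB: "v \<in> ?VA" "v \<in> ?VB" "f v = v" if "v \<in> S" for v
    using that S fVB(1)[of v] by auto
  have "(\<Sum>\<phi>\<in>?VB \<rightarrow>\<^sub>E ?N. tree_law I B \<phi> * F (restrict \<phi> S))
      = (\<Sum>\<psi>\<in>?VA \<rightarrow>\<^sub>E ?N. tree_law I A \<psi> * F (restrict \<psi> S))"
  proof (rule sum.reindex_bij_witness[where i = "\<lambda>\<psi>. restrict (\<psi> \<circ> ?g) ?VB"
        and j = "\<lambda>\<phi>. restrict (\<phi> \<circ> f) ?VA"])
    fix \<phi> assume \<phi>: "\<phi> \<in> ?VB \<rightarrow>\<^sub>E ?N"
    let ?\<psi> = "restrict (\<phi> \<circ> f) ?VA"
    show "restrict (?\<psi> \<circ> ?g) ?VB = \<phi>"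
      using \<phi> g by (auto simp: fun_eq_iff restrict_def PiE_def extensional_def)
    show "?\<psi> \<in> ?VA \<rightarrow>\<^sub>E ?N"
      using \<phi> fVB(1) by auto
    have "(\<Prod>v\<in>?VA. vertex_law I v (?\<psi> v)) = (\<Prod>v\<in>?VA. vertex_law I (f v) (\<phi> (f v)))"
      by (intro prod.cong refl) (simp add: vertex_law_def I)
    also have "\<dots> = (\<Prod>w\<in>?VB. vertex_law I w (\<phi> w))"
      using prod.reindex_bij_betw[OF bij, of "\<lambda>w. vertex_law I w (\<phi> w)"] .
    finally have vp: "(\<Prod>v\<in>?VA. vertex_law I v (?\<psi> v)) = (\<Prod>w\<in>?VB. vertex_law I w (\<phi> w))" .
    have "(\<Prod>e\<in>edges A. edge_weight (?\<psi> ` e)) = (\<Prod>e\<in>edges A. edge_weight (\<phi> ` (f ` e)))"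
    proof (rule prod.cong[OF refl])
      fix e assume "e \<in> edges A"
      then have "e \<subseteq> ?VA" using simple_graphD(5)[OF f(2)] by blast
      then have "?\<psi> ` e = \<phi> ` (f ` e)" by (auto simp: image_iff)
      then show "edge_weight (?\<psi> ` e) = edge_weight (\<phi> ` (f ` e))" by (rule arg_cong)
    qed
    also have "\<dots> = (\<Prod>e\<in>edges B. edge_weight (\<phi> ` e))"
      using prod.reindex_bij_betw[OF isomorphism_edges[OF f], of "\<lambda>e. edge_weight (\<phi> ` e)"] .
    finally have "tree_law I A ?\<psi> = tree_law I B \<phi>"
      unfolding tree_law_def vp by (rule arg_cong)
    moreover have "restrict ?\<psi> S = restrict \<phi> S"
      using SB by (auto simp: fun_eq_iff restrict_def)
    ultimately show "tree_law I A ?\<psi> * F (restrict ?\<psi> S) = tree_law I B \<phi> * F (restrict \<phi> S)"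
      by simp
  next
    fix \<psi> assume \<psi>: "\<psi> \<in> ?VA \<rightarrow>\<^sub>E ?N"
    then show "restrict (restrict (\<psi> \<circ> ?g) ?VB \<circ> f) ?VA = \<psi>"
      using fVB by (auto simp: fun_eq_iff restrict_def PiE_def extensional_def)
    show "restrict (\<psi> \<circ> ?g) ?VB \<in> ?VB \<rightarrow>\<^sub>E ?N"
      using \<psi> g(1) by auto
  qed
  also have "\<dots> = (\<Sum>\<psi>\<in>S \<rightarrow>\<^sub>E ?N. m \<psi> * F \<psi>)"
    by (rule is_marginalD[OF m])
  finally show "(\<Sum>\<phi>\<in>?VB \<rightarrow>\<^sub>E ?N. tree_law I B \<phi> * F (restrict \<phi> S))
      = (\<Sum>\<psi>\<in>S \<rightarrow>\<^sub>E ?N. m \<psi> * F \<psi>)" .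
qed

lemma is_marginal_empty:
  "is_marginal N {} A m g \<longleftrightarrow> sum g (A \<rightarrow>\<^sub>E N) = m (\<lambda>_. undefined)"
  by (auto simp: is_marginal_def restrict_def simp flip: sum_distrib_right dest: spec[of _ "\<lambda>_. 1"])

text \<open>The law on \<open>S\<close> is carried down from \<open>P\<close> to its minimal
  subtree, across the isomorphism, and up from the other minimal subtree to
  \<open>Q\<close>.\<close>

lemma tree_law_common_marginal:
  assumes P: "is_tree P" "\<Union>(edges P) \<subseteq> I" and Q: "is_tree Q" "\<Union>(edges Q) \<subseteq> I"
    and A: "minimal_subtree P S A" and B: "minimal_subtree Q S B"
    and f: "is_isomorphism f A B" "\<And>v. v \<in> S \<Longrightarrow> f v = v"
    and m: "is_marginal (vertices G) S (vertices P) m (tree_law I P)"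
  shows "is_marginal (vertices G) S (vertices Q) m (tree_law I Q)"
proof (cases "S = {}")
  \<comment> \<open>For disjoint bags the minimal subtrees are single vertices, and \<open>f\<close>
    may match an isolated vertex of the source graph with a non-isolated one. Transport could then
    fail, but on the empty set only the total mass matters.\<close>
  case True
  then show ?thesis
    using m by (simp add: is_marginal_empty sum_tree_law P Q)
next
  case False
  have A': "is_subgraph A P" "is_connected A" "simple_graph A" "S \<subseteq> vertices A" "edges A \<subseteq> edges P"
    and B': "is_subgraph B Q" "is_connected B" "simple_graph B" "S \<subseteq> vertices B" "edges B \<subseteq> edges Q"
    using A B by (auto simp: minimal_subtree_def is_tree_def is_subgraph_def)
  have bij: "inj_on f (vertices A)" "f ` vertices A = vertices B"
    using f(1) by (auto simp: is_isomorphism_def bij_betw_def)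
  have "f v \<in> I \<longleftrightarrow> v \<in> I" if v: "v \<in> vertices A" for v
  proof (cases "v \<in> S")
    case True
    then show ?thesis using f(2) by simp
  next
    case nS: False
    \<comment> \<open>A second vertex in the connected graph \<open>A\<close> forces an edge at
      \<open>v\<close>, and likewise one at \<open>f v\<close> in \<open>B\<close>; so both lie in
      \<open>I\<close>.\<close>
    obtain s where s: "s \<in> S" "s \<in> vertices A" "s \<noteq> v" using False nS A'(4) by blast
    then have "f s \<noteq> f v" "f s \<in> vertices B" "f v \<in> vertices B"
      using bij v by (auto simp: inj_on_eq_iff)
    then have "v \<in> \<Union>(edges A)" "f v \<in> \<Union>(edges B)"
      using connected_vertex_in_edge[OF A'(2) v s(2)] connected_vertex_in_edge[OF B'(2), of "f v" "f s"] s
      by auto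
    then show ?thesis using A'(5) B'(5) P(2) Q(2) by blast
  qed
  moreover have "is_marginal (vertices G) S (vertices A) m (tree_law I A)"
    using m tree_law_marginal(1)[OF P A'(1,2)] A'(4) by (rule is_marginal_between)
  ultimately have "is_marginal (vertices G) S (vertices B) m (tree_law I B)"
    using f A'(3,4) B'(3) by (intro tree_law_marginal_isomorphism[of f A B])
  then show ?thesis
    using tree_law_marginal(1)[OF Q B'(1,2)] B'(4) by (rule is_marginal_trans)
qed

text \<open>Subadditivity of entropy: Gibbs' inequality against the product of the vertex laws,
  which is positive on the support of \<open>m\<close> because its factors are marginals of
  \<open>m\<close>.\<close>

lemma log_sum_ge_vertex_logs:
  assumes S: "finite S" and nonneg: "\<And>\<sigma>. \<sigma> \<in> S \<rightarrow>\<^sub>E vertices G \<Longrightarrow> 0 \<le> m \<sigma>"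
    and sum: "sum m (S \<rightarrow>\<^sub>E vertices G) = 1"
    and marg: "\<And>v. v \<in> S \<Longrightarrow> is_marginal (vertices G) {v} S (\<lambda>\<phi>. vertex_law I v (\<phi> v)) m"
  shows "(\<Sum>v\<in>S. vertex_log I v) \<le> (\<Sum>\<sigma>\<in>S \<rightarrow>\<^sub>E vertices G. m \<sigma> * ln (m \<sigma>))"
proof -
  let ?N = "vertices G"
  let ?q = "\<lambda>\<sigma>. \<Prod>v\<in>S. vertex_law I v (\<sigma> v)"
  have pos: "0 < vertex_law I v (\<sigma> v)" if "\<sigma> \<in> S \<rightarrow>\<^sub>E ?N" "0 < m \<sigma>" "v \<in> S" for \<sigma> v
    using marginal_pos[OF marg[OF that(3)] host(1) S _ nonneg that(1,2)] that(3) by simp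
  have "(\<Sum>v\<in>S. vertex_log I v) = (\<Sum>v\<in>S. \<Sum>\<sigma>\<in>S \<rightarrow>\<^sub>E ?N. m \<sigma> * ln (vertex_law I v (\<sigma> v)))"
    using vertex_marginalD[OF marg, where F = "\<lambda>x. ln (vertex_law I _ x)"]
    by (simp add: vertex_log_def cong: sum.cong)
  also have "\<dots> = (\<Sum>\<sigma>\<in>S \<rightarrow>\<^sub>E ?N. m \<sigma> * (\<Sum>v\<in>S. ln (vertex_law I v (\<sigma> v))))"
    by (subst sum.swap) (simp add: sum_distrib_left)
  also have "\<dots> = (\<Sum>\<sigma>\<in>S \<rightarrow>\<^sub>E ?N. m \<sigma> * ln (?q \<sigma>))"
  proof (rule sum.cong[OF refl])
    fix \<sigma> assume \<sigma>: "\<sigma> \<in> S \<rightarrow>\<^sub>E ?N"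
    show "m \<sigma> * (\<Sum>v\<in>S. ln (vertex_law I v (\<sigma> v))) = m \<sigma> * ln (?q \<sigma>)"
    proof (cases "m \<sigma> = 0")
      case False
      then have "0 < m \<sigma>" using nonneg[OF \<sigma>] by simp
      then have "vertex_law I v (\<sigma> v) \<noteq> 0" if "v \<in> S" for v
        using pos[OF \<sigma> _ that] by simp
      then show ?thesis by (simp add: ln_prod S)
    qed simp
  qed
  also have "\<dots> \<le> (\<Sum>\<sigma>\<in>S \<rightarrow>\<^sub>E ?N. m \<sigma> * ln (m \<sigma>))"
  proof (rule gibbs_inequality)
    show "0 < ?q \<sigma>" if "\<sigma> \<in> S \<rightarrow>\<^sub>E ?N" "0 < m \<sigma>" for \<sigma>
      using pos that by (intro prod_pos) simp
    have "sum ?q (S \<rightarrow>\<^sub>E ?N) = (\<Prod>v\<in>S. sum (vertex_law I v) ?N)"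
      by (rule prod_sum_PiE[symmetric]) (use S host(1) in simp_all)
    then show "sum ?q (S \<rightarrow>\<^sub>E ?N) \<le> sum m (S \<rightarrow>\<^sub>E ?N)"
      by (simp add: sum_vertex_law sum)
  qed (use nonneg in \<open>simp_all add: prod_nonneg vertex_law_nonneg\<close>)
  finally show ?thesis .
qed

end

section \<open>Coupling the bags along the decomposition tree\<close>

lemma induced_simps [simp]:
  "vertices (induced H X) = X" "edges (induced H X) = {e \<in> edges H. e \<subseteq> X}"
  by (simp_all add: induced_def)

lemma strong_tree_decompositionD:
  assumes "strong_tree_decomposition H \<F> \<T>"
  shows "is_tree \<T>" "vertices \<T> = \<F>" "\<Union>\<F> = vertices H"
    and "{v, w} \<in> edges H \<Longrightarrow> \<exists>X\<in>\<F>. v \<in> X \<and> w \<in> X"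
    and "\<lbrakk>path_between \<T> X p Y; Z \<in> set p\<rbrakk> \<Longrightarrow> X \<inter> Y \<subseteq> Z"
    and "X \<in> \<F> \<Longrightarrow> is_tree (induced H X)"
    and "\<lbrakk>X \<in> \<F>; Y \<in> \<F>; X \<noteq> Y; e \<in> edges H; e \<subseteq> X\<rbrakk> \<Longrightarrow> \<not> e \<subseteq> Y"
    and "\<lbrakk>X \<in> \<F>; Y \<in> \<F>; {X, Y} \<in> edges \<T>\<rbrakk> \<Longrightarrow>
      \<exists>A B f. minimal_subtree (induced H X) (X \<inter> Y) A \<and> minimal_subtree (induced H Y) (X \<inter> Y) B \<and>
        is_isomorphism f A B \<and> (\<forall>v\<in>X \<inter> Y. f v = v)"
proof -
  have dec: "tree_decomposition H \<F> \<T>"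
    using assms by (simp add: strong_tree_decomposition_def)
  then show "is_tree \<T>" "vertices \<T> = \<F>" "\<Union>\<F> = vertices H"
    "{v, w} \<in> edges H \<Longrightarrow> \<exists>X\<in>\<F>. v \<in> X \<and> w \<in> X"
    by (simp_all add: tree_decomposition_def)
  show "X \<inter> Y \<subseteq> Z" if p: "path_between \<T> X p Y" and Z: "Z \<in> set p"
  proof -
    have "set p \<subseteq> \<F>" "X \<in> set p" "Y \<in> set p"
      using p dec by (auto simp: path_between_def is_path_def tree_decomposition_def)
    then show ?thesis using dec p Z unfolding tree_decomposition_def by blast
  qed
  show "X \<in> \<F> \<Longrightarrow> is_tree (induced H X)"
    using assms by (simp add: strong_tree_decomposition_def)
  show "\<not> e \<subseteq> Y" if "X \<in> \<F>" "Y \<in> \<F>" "X \<noteq> Y" "e \<in> edges H" "e \<subseteq> X"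
  proof -
    have "\<forall>X\<in>\<F>. \<forall>Y\<in>\<F>. X \<noteq> Y \<longrightarrow> edges (induced H X) \<inter> edges (induced H Y) = {}"
      using assms unfolding strong_tree_decomposition_def by (elim conjE)
    with that(1-3) have "edges (induced H X) \<inter> edges (induced H Y) = {}" by blast
    then show ?thesis using that(4,5) by auto
  qed
  show "\<exists>A B f. minimal_subtree (induced H X) (X \<inter> Y) A \<and> minimal_subtree (induced H Y) (X \<inter> Y) B \<and>
        is_isomorphism f A B \<and> (\<forall>v\<in>X \<inter> Y. f v = v)"
    if "X \<in> \<F>" "Y \<in> \<F>" "{X, Y} \<in> edges \<T>"
    using assms that unfolding strong_tree_decomposition_def by blast
qed

text \<open>A path of \<open>B\<close> from any bag \<open>Z\<close> to \<open>X\<close> extends by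
  \<open>Y\<close>. Then \<open>X\<close> lies on the path from \<open>Z\<close> to
  \<open>Y\<close>, and the path condition gives \<open>Z \<inter> Y \<subseteq> X\<close>.\<close>

lemma bag_Int_Union:
  assumes dec: "strong_tree_decomposition H \<F> \<T>" and B: "is_subgraph B \<T>" "is_connected B"
    and XY: "X \<in> vertices B" "Y \<in> vertices \<T>" "Y \<notin> vertices B" "{X, Y} \<in> edges \<T>"
  shows "\<Union>(vertices B) \<inter> Y = X \<inter> Y"
proof -
  have "Z \<inter> Y \<subseteq> X" if Z: "Z \<in> vertices B" for Z
  proof -
    obtain p where p: "path_between B Z p X"
      using B(2) Z XY(1) unfolding is_connected_def by blast
    have "path_between \<T> Z p X"
      using B(1) by (intro path_between_mono[OF p]) (simp_all add: is_subgraph_def)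
    moreover have "Y \<notin> set p" using path_between_set[OF p] XY(3) by blast
    ultimately have "path_between \<T> Z (p @ [Y]) Y"
      using XY by (intro path_between_snoc)
    moreover have "X \<in> set (p @ [Y])"
      using p by (auto simp: path_between_def is_path_def)
    ultimately show ?thesis by (rule strong_tree_decompositionD(5)[OF dec])
  qed
  then show ?thesis using XY(1) by blast
qed

context host_graph begin

text \<open>The marginals on all bags are kept through the induction: the one on \<open>X\<close>
  provides the overlap when a neighbour of \<open>X\<close> is attached, and at the end they show
  that the coupling charges homomorphisms only.\<close>

lemma bag_laws_glue:
  fixes H :: "'a sgraph"
  assumes H: "simple_graph H" and dec: "strong_tree_decomposition H \<F> \<T>"
  defines "I \<equiv> \<Union>(edges H)"
  shows "\<exists>f :: ('a \<Rightarrow> 'b) \<Rightarrow> real. (\<forall>\<phi>\<in>vertices H \<rightarrow>\<^sub>E vertices G. 0 \<le> f \<phi>) \<and>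
    (\<forall>X\<in>\<F>. is_marginal (vertices G) X (vertices H) (tree_law I (induced H X)) f) \<and>
    (\<Sum>\<phi>\<in>vertices H \<rightarrow>\<^sub>E vertices G. f \<phi> * ln (f \<phi>))
      \<le> (\<Sum>v\<in>vertices H. vertex_log I v) + real (card (edges H)) * edge_log"
proof -
  note D = strong_tree_decompositionD[OF dec]
  let ?N = "vertices G" and ?l = "\<lambda>X. tree_law I (induced H X)"
  define E where "E B = {e \<in> edges H. \<exists>X\<in>vertices B. e \<subseteq> X}" for B :: "'a set sgraph"
  define P where "P B \<longleftrightarrow> (\<exists>f :: ('a \<Rightarrow> 'b) \<Rightarrow> real.
    (\<forall>\<phi>\<in>\<Union>(vertices B) \<rightarrow>\<^sub>E ?N. 0 \<le> f \<phi>) \<and>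
    (\<forall>X\<in>vertices B. is_marginal ?N X (\<Union>(vertices B)) (?l X) f) \<and>
    (\<Sum>\<phi>\<in>\<Union>(vertices B) \<rightarrow>\<^sub>E ?N. f \<phi> * ln (f \<phi>))
      \<le> (\<Sum>v\<in>\<Union>(vertices B). vertex_log I v) + real (card (E B)) * edge_log)" for B :: "'a set sgraph"
  have finH: "finite (vertices H)" "finite (edges H)" using simple_graphD[OF H] by blast+
  have edges_I: "\<Union>(edges (induced H X)) \<subseteq> I" for X by (auto simp: I_def)
  have bag: "X \<subseteq> vertices H" "finite X" if "X \<in> \<F>" for X
  proof -
    show "X \<subseteq> vertices H" using that D(3) by blast
    then show "finite X" using finH(1) by (rule finite_subset)
  qed
  obtain X0 where X0: "X0 \<in> vertices \<T>"
    using D(1) by (auto simp: is_tree_def is_connected_def)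
  then have "is_subgraph (SGraph {X0} {}) \<T>"
    by (simp add: is_subgraph_def simple_graph_def)
  from D(1) this connected_singleton have "P \<T>"
  proof (induction rule: tree_induct)
    case base
    have "X0 \<in> \<F>" using X0 D(2) by simp
    then show ?case
      using tree_law_log_sum[OF D(6) edges_I, of X0]
      by (auto simp: P_def E_def tree_law_nonneg is_marginal_refl intro!: exI[of _ "?l X0"])
  next
    case (attach B X Y)
    let ?U = "\<Union>(vertices B)" and ?S = "X \<inter> Y"
    let ?m = "marginal ?N ?S X (?l X)"
    have XY: "X \<in> \<F>" "Y \<in> \<F>" "vertices B \<subseteq> \<F>"
      using attach.hyps D(2) by (auto simp: is_subgraph_def)
    have S: "?U \<inter> Y = ?S"
      using bag_Int_Union[OF dec attach.hyps(1-6)] .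
    have U: "finite ?U" "X \<subseteq> ?U"
      using XY(3) D(3) finH(1) attach.hyps(3) by (auto intro: finite_subset[of _ "vertices H"])
    have Y: "finite Y" using bag(2) XY(2) .
    obtain f where f: "\<And>\<phi>. \<phi> \<in> ?U \<rightarrow>\<^sub>E ?N \<Longrightarrow> 0 \<le> f \<phi>"
        "\<And>X. X \<in> vertices B \<Longrightarrow> is_marginal ?N X ?U (?l X) f"
        "(\<Sum>\<phi>\<in>?U \<rightarrow>\<^sub>E ?N. f \<phi> * ln (f \<phi>)) \<le> (\<Sum>v\<in>?U. vertex_log I v) + real (card (E B)) * edge_log"
      using attach.IH unfolding P_def by blast
    have mX: "is_marginal ?N ?S X ?m (?l X)"
      using host(1) bag XY(1) by (intro is_marginal_marginal) auto
    have mY: "is_marginal ?N ?S Y ?m (?l Y)"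
    proof -
      obtain A B g where g: "minimal_subtree (induced H X) ?S A" "minimal_subtree (induced H Y) ?S B"
          "is_isomorphism g A B" "\<And>v. v \<in> ?S \<Longrightarrow> g v = v"
        using D(8)[OF XY(1,2) attach.hyps(6)] by blast
      show ?thesis
        using tree_law_common_marginal[OF D(6)[OF XY(1)] edges_I D(6)[OF XY(2)] edges_I g] mX
        by simp
    qed
    \<comment> \<open>The overlap lies inside the single bag \<open>X\<close>, whose law is already
      a marginal of the coupling built so far.\<close>
    have mU: "is_marginal ?N (?U \<inter> Y) ?U ?m f"
      unfolding S using mX f(2)[OF attach.hyps(3)] by (rule is_marginal_trans) blast
    have mY': "is_marginal ?N (?U \<inter> Y) Y ?m (?l Y)" using mY S by simp
    have m0: "0 \<le> ?m \<sigma>" for \<sigma> by (intro marginal_nonneg tree_law_nonneg)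
    let ?h = "glue ?U Y ?m f (?l Y)"
    have UY: "\<Union>(vertices (attach B X Y)) = ?U \<union> Y" by auto
    have h0: "0 \<le> ?h \<phi>" if "\<phi> \<in> ?U \<union> Y \<rightarrow>\<^sub>E ?N" for \<phi>
    proof -
      have "restrict \<phi> ?U \<in> ?U \<rightarrow>\<^sub>E ?N" using that by (rule restrict_PiE_mono) blast
      then show ?thesis by (simp add: glue_def f(1) m0 tree_law_nonneg)
    qed
    have hU: "is_marginal ?N ?U (?U \<union> Y) f ?h"
      using host(1) U(1) Y mU f(1) mY' by (rule is_marginal_glue1)
    have hY: "is_marginal ?N Y (?U \<union> Y) (?l Y) ?h"
      using host(1) U(1) Y mU mY' tree_law_nonneg by (rule is_marginal_glue2)
    have hB: "is_marginal ?N Z (?U \<union> Y) (?l Z) ?h" if "Z \<in> vertices (attach B X Y)" for Z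
    proof (cases "Z = Y")
      case False
      then have Z: "Z \<in> vertices B" using that by simp
      show ?thesis using f(2)[OF Z] hU by (rule is_marginal_trans) (use Z in blast)
    qed (simp add: hY)
    have E: "real (card (E (attach B X Y))) = real (card (E B)) + real (card (edges (induced H Y)))"
    proof -
      have "E (attach B X Y) = E B \<union> edges (induced H Y)" by (auto simp: E_def)
      moreover have "E B \<inter> edges (induced H Y) = {}"
        using D(7) XY attach.hyps(5) by (fastforce simp: E_def)
      moreover have "finite (E B)" "finite (edges (induced H Y))"
        using finH by (simp_all add: E_def)
      ultimately show ?thesis by (simp add: card_Un_disjoint)
    qed
    \<comment> \<open>The overlap enters the glued sum with a minus sign, so a lower bound for its
      term is the right direction.\<close>
    have lm: "(\<Sum>v\<in>?S. vertex_log I v) \<le> (\<Sum>\<sigma>\<in>?S \<rightarrow>\<^sub>E ?N. ?m \<sigma> * ln (?m \<sigma>))"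
    proof (rule log_sum_ge_vertex_logs)
      show "sum ?m (?S \<rightarrow>\<^sub>E ?N) = 1"
        using is_marginal_sum[OF mX] sum_tree_law[OF D(6)[OF XY(1)] edges_I] by simp
      show "is_marginal ?N {v} ?S (\<lambda>\<phi>. vertex_law I v (\<phi> v)) ?m" if "v \<in> ?S" for v
      proof -
        have "is_marginal ?N {v} X (\<lambda>\<phi>. vertex_law I v (\<phi> v)) (?l X)"
          using tree_law_vertex_marginal[OF D(6)[OF XY(1)] edges_I, of v] that by simp
        then show ?thesis using mX by (rule is_marginal_between) (use that in simp)
      qed
    qed (simp_all add: Y m0)
    have "(\<Sum>\<phi>\<in>?U \<union> Y \<rightarrow>\<^sub>E ?N. ?h \<phi> * ln (?h \<phi>))
        = (\<Sum>\<phi>\<in>?U \<rightarrow>\<^sub>E ?N. f \<phi> * ln (f \<phi>)) + (\<Sum>\<phi>\<in>Y \<rightarrow>\<^sub>E ?N. ?l Y \<phi> * ln (?l Y \<phi>))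
          - (\<Sum>\<sigma>\<in>?S \<rightarrow>\<^sub>E ?N. ?m \<sigma> * ln (?m \<sigma>))"
      using glue_log_sum[OF host(1) U(1) Y mU f(1) mY' tree_law_nonneg] unfolding S .
    also have "\<dots> \<le> ((\<Sum>v\<in>?U. vertex_log I v) + real (card (E B)) * edge_log)
        + ((\<Sum>v\<in>Y. vertex_log I v) + real (card (edges (induced H Y))) * edge_log)
        - (\<Sum>v\<in>?S. vertex_log I v)"
      using f(3) lm tree_law_log_sum[OF D(6)[OF XY(2)] edges_I] by simp
    \<comment> \<open>Inclusion-exclusion: the overlap occurs in both vertex sums and is subtracted
      once.\<close>
    also have "\<dots> = (\<Sum>v\<in>?U \<union> Y. vertex_log I v) + real (card (E (attach B X Y))) * edge_log"
      using sum.union_inter[OF U(1) Y, of "vertex_log I"] unfolding S E by (simp add: algebra_simps)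
    finally show ?case
      unfolding P_def UY using h0 hB by blast
  qed
  moreover have "E \<T> = edges H"
  proof -
    have "\<exists>X\<in>\<F>. e \<subseteq> X" if e: "e \<in> edges H" for e
    proof -
      obtain v w where "e = {v, w}" using simple_graphD(4)[OF H e] by (auto simp: card_2_iff)
      then show ?thesis using D(4)[of v w] e by auto
    qed
    then show ?thesis by (auto simp: E_def D(2))
  qed
  ultimately show ?thesis
    unfolding P_def D(2,3) by simp
qed

end

section \<open>From entropy to the number of homomorphisms\<close>

lemma card_nonisolated_le:
  assumes "simple_graph H"
  shows "card (\<Union>(edges H)) \<le> 2 * card (edges H)"
proof -
  have "card (\<Union>(edges H)) \<le> (\<Sum>e\<in>edges H. card e)"
    by (rule card_Union_le_sum_card)
  also have "\<dots> = 2 * card (edges H)"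
    using simple_graphD(4)[OF assms] by simp
  finally show ?thesis .
qed

context host_graph begin

lemma stationary_log_ge:
  "- ln (real (card (vertices G))) \<le> (\<Sum>x\<in>vertices G. stationary x * ln (stationary x))"
  using entropy_le_ln_card(1)[OF host(1) stationary_nonneg sum_stationary subset_refl] by simp

lemma vertex_log_total_le:
  fixes H :: "'a sgraph"
  assumes "simple_graph H"
  shows "(\<Sum>v\<in>vertices H. vertex_log (\<Union>(edges H)) v) + real (card (edges H)) * edge_log
    \<le> - (real (card (vertices H)) * ln (real (card (vertices G)))
        + real (card (edges H)) * ln (2 * real (card (edges G)) / real (card (vertices G)) ^ 2))"
proof -
  let ?I = "\<Union>(edges H)" and ?V = "vertices H" and ?n = "real (card (vertices G))"
    and ?k = "real (card (edges H))" and ?m = "2 * real (card (edges G))"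
  let ?L = "\<Sum>x\<in>vertices G. stationary x * ln (stationary x)"
  have fin: "finite ?V" "?I \<subseteq> ?V" "finite ?I"
    using simple_graphD[OF assms] by (blast intro: finite_subset[of ?I ?V])+
  have "(\<Sum>v\<in>?V. vertex_log ?I v) = (\<Sum>v\<in>?I. vertex_log ?I v) + (\<Sum>v\<in>?V - ?I. vertex_log ?I v)"
    using sum.subset_diff[OF fin(2,1), of "vertex_log ?I"] by (simp add: add.commute)
  also have "\<dots> = real (card ?I) * ?L - (real (card ?V) - real (card ?I)) * ln ?n"
    using card_Diff_subset[OF fin(3,2)] card_mono[OF fin(1,2)]
    by (simp add: vertex_log_mem vertex_log_not_mem of_nat_diff)
  finally have "(\<Sum>v\<in>?V. vertex_log ?I v) + ?k * edge_log
      = - (2 * ?k - real (card ?I)) * (?L + ln ?n) - (real (card ?V) * ln ?n + ?k * (ln ?m - 2 * ln ?n))"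
    by (simp only: edge_log_def) (simp add: algebra_simps)
  \<comment> \<open>This product is the slack over Sidorenko's bound. Each edge covers only two
    vertices, and \<open>- ?L\<close>, the entropy of the stationary law, is at most
    \<open>ln ?n\<close>.\<close>
  moreover have "0 \<le> (2 * ?k - real (card ?I)) * (?L + ln ?n)"
    using card_nonisolated_le[OF assms] stationary_log_ge by (intro mult_nonneg_nonneg) linarith+
  moreover have "ln (?m / ?n ^ 2) = ln ?m - 2 * ln ?n"
    using card_vertices_G_pos card_edges_G_pos by (subst ln_div) (simp_all add: ln_realpow)
  ultimately show ?thesis by (simp only: mult_minus_left)
qed

lemma card_Hom_ge:
  fixes H :: "'a sgraph"
  assumes H: "simple_graph H" and dec: "strong_tree_decomposition H \<F> \<T>"
  shows "real (card (vertices G)) ^ card (vertices H) *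
      (2 * real (card (edges G)) / real (card (vertices G)) ^ 2) ^ card (edges H)
    \<le> real (card (Hom H G))"
proof -
  note D = strong_tree_decompositionD[OF dec]
  let ?N = "vertices G" and ?V = "vertices H" and ?I = "\<Union>(edges H)"
  obtain f :: "('a \<Rightarrow> 'b) \<Rightarrow> real" where f: "\<And>\<phi>. \<phi> \<in> ?V \<rightarrow>\<^sub>E ?N \<Longrightarrow> 0 \<le> f \<phi>"
      "\<And>X. X \<in> \<F> \<Longrightarrow> is_marginal ?N X ?V (tree_law ?I (induced H X)) f"
      "(\<Sum>\<phi>\<in>?V \<rightarrow>\<^sub>E ?N. f \<phi> * ln (f \<phi>))
        \<le> (\<Sum>v\<in>?V. vertex_log ?I v) + real (card (edges H)) * edge_log"
    using bag_laws_glue[OF H dec] by blast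
  have finV: "finite ?V" using simple_graphD(1)[OF H] .
  obtain X0 where X0: "X0 \<in> \<F>"
    using D(1,2) by (auto simp: is_tree_def is_connected_def)
  have "\<Union>(edges (induced H X0)) \<subseteq> ?I" by auto
  then have sum_f: "sum f (?V \<rightarrow>\<^sub>E ?N) = 1"
    using is_marginal_sum[OF f(2)[OF X0]] sum_tree_law[OF D(6)[OF X0], of ?I] by simp
  \<comment> \<open>Each edge of \<open>H\<close> lies in some bag. A map of positive mass restricts
    to one of positive mass under that bag's law, so the factor of the edge is nonzero and its image
    is an edge of \<open>G\<close>.\<close>
  have supp: "\<phi> \<in> Hom H G" if \<phi>: "\<phi> \<in> ?V \<rightarrow>\<^sub>E ?N" "0 < f \<phi>" for \<phi>
  proof -
    have "{\<phi> v, \<phi> w} \<in> edges G" if e: "{v, w} \<in> edges H" for v w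
    proof -
      obtain X where X: "X \<in> \<F>" "v \<in> X" "w \<in> X" using D(4)[OF e] by blast
      have sub: "X \<subseteq> ?V" using X(1) D(3) by blast
      have pos: "0 < tree_law ?I (induced H X) (restrict \<phi> X)"
        using f(2)[OF X(1)] host(1) finV sub f(1) \<phi> by (rule marginal_pos)
      have fin: "finite (edges (induced H X))" and vw: "{v, w} \<in> edges (induced H X)"
        using simple_graphD(2)[OF H] e X by simp_all
      have "edge_weight (restrict \<phi> X ` {v, w}) \<noteq> 0"
      proof
        assume "edge_weight (restrict \<phi> X ` {v, w}) = 0"
        then have "(\<Prod>e\<in>edges (induced H X). edge_weight (restrict \<phi> X ` e)) = 0"
          by (intro prod_zero[OF fin] bexI[OF _ vw])
        then show False using pos by (simp only: tree_law_def mult_zero_right less_irrefl)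
      qed
      then show ?thesis using X by (auto simp: edge_weight_def)
    qed
    then show ?thesis using \<phi>(1) by (simp add: Hom_def)
  qed
  have fin: "finite (?V \<rightarrow>\<^sub>E ?N)" using finV host(1) by (intro finite_PiE)
  have "Hom H G \<subseteq> ?V \<rightarrow>\<^sub>E ?N" by (auto simp: Hom_def)
  note ent = entropy_le_ln_card[OF fin f(1) sum_f this supp]
  let ?n = "real (card ?N)" and ?d = "2 * real (card (edges G)) / real (card ?N) ^ 2"
  have pos: "0 < ?n" "0 < ?d" using card_vertices_G_pos card_edges_G_pos by simp_all
  have "ln (?n ^ card ?V * ?d ^ card (edges H))
      = real (card ?V) * ln ?n + real (card (edges H)) * ln ?d"
    using zero_less_power[OF pos(1), of "card ?V"] zero_less_power[OF pos(2), of "card (edges H)"]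
    by (simp only: ln_mult_pos ln_realpow)
  also have "\<dots> \<le> ln (card (Hom H G))"
    using ent(1) f(3) vertex_log_total_le[OF H] by linarith
  finally have "ln (?n ^ card ?V * ?d ^ card (edges H)) \<le> ln (real (card (Hom H G)))" .
  moreover have "0 < ?n ^ card ?V * ?d ^ card (edges H)"
    using pos by (intro mult_pos_pos zero_less_power)
  \<comment> \<open>Logarithms cancel only between positive numbers; \<open>Hom H G\<close> is
    nonempty because it contains the support of \<open>f\<close>.\<close>
  ultimately show ?thesis using ent(2) by (simp only: ln_le_cancel_iff of_nat_0_less_iff)
qed

end

theorem theorem1p2:
  fixes H :: "'a sgraph"
  assumes "simple_graph H"
    and "strongly_tree_decomposable H"
  shows "sidorenko_property TYPE('b) H"
  unfolding sidorenko_property_def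
proof (intro allI impI)
  fix G :: "'b sgraph" assume G: "simple_graph G"
  obtain \<F> \<T> where dec: "strong_tree_decomposition H \<F> \<T>"
    using assms(2) unfolding strongly_tree_decomposable_def by blast
  show "real (card (vertices G)) ^ card (vertices H) *
      (2 * real (card (edges G)) / real (card (vertices G)) ^ 2) ^ card (edges H)
    \<le> real (card (Hom H G))"
  proof (cases "edges G = {}")
    case False
    then interpret host_graph G by unfold_locales (rule G)
    show ?thesis by (rule card_Hom_ge[OF assms(1) dec])
  next
    \<comment> \<open>Without edges in \<open>G\<close> there is no stationary law, and the density
      is 0 (also for the graph without vertices). The bound is then 0 unless \<open>H\<close> has no
      edges, where 0 to the power 0 is 1 and every map is a homomorphism.\<close>
    case True
    show ?thesis
    proof (cases "edges H = {}")
      case True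
      then have "Hom H G = vertices H \<rightarrow>\<^sub>E vertices G" by (auto simp: Hom_def)
      then show ?thesis using True simple_graphD(1)[OF assms(1)] by (simp add: card_funcsetE)
    next
      case False
      then have "0 < card (edges H)" using simple_graphD(2)[OF assms(1)] by (simp add: card_gt_0_iff)
      then show ?thesis using \<open>edges G = {}\<close> by (simp add: zero_power)
    qed
  qed
qed

end
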